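(* Let $n\ge 2$ and $1\le d\le n$ be integers. Then: (1) The functor $\sigma_{K_{n+1}}^{-1}\circ\inf\colon \operatorname{rep}(K_{d+1})\to\operatorname{rep}(K_{n+1})$ is left adjoint to $\sigma_{K_{d+1}}\circ\operatorname{res}\colon \operatorname{rep}(K_{n+1})\to\operatorname{rep}(K_{d+1})$. (2) The functor $\sigma_{K_{d+1}}^{-1}\circ\operatorname{res}\colon \operatorname{rep}(K_{n+1})\to\operatorname{rep}(K_{d+1})$ is left adjoint to $\sigma_{K_{n+1}}\circ\inf\colon \operatorname{rep}(K_{d+1})\to\operatorname{rep}(K_{n+1})$.
   Context: $\mathbb{K}$ is an algebraically closed field of arbitrary characteristic. For $r\ge 1$, $K_r$ is the generalized Kronecker quiver with vertices $1,2$ and $r$ arrows $\gamma_1,\dots,\gamma_r\colon 1\to 2$, and $A_r:=\bigoplus_{i=1}^r\mathbb{K}\gamma_i$. Objects of $\operatorname{rep}(K_r)$ are identified with triples $M=(M_1,M_2,\psi_M)$ with $M_1,M_2$ finite-dimensional $\mathbb{K}$-vector spaces and $\psi_M\colon A_r\otimes_{\mathbb{K}}M_1\to M_2$ a linear map; a morphism $f\colon M\to N$ is a pair of linear maps $f_i\colon M_i\to N_i$ with $f_2\circ\psi_M=\psi_N\circ(\mathrm{id}_{A_r}\otimes f_1)$. Restriction and inflation. For $s\le r$ let $\iota\colon A_s\to A_r$ be the embedding $\gamma_i\mapsto\gamma_i$ ($1\le i\le s$). The functor $\operatorname{res}\colon\operatorname{rep}(K_r)\to\operatorname{rep}(K_s)$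 is $\operatorname{res}(M)=(M_1,M_2,\psi_M\circ(\iota\otimes\mathrm{id}_{M_1}))$. The functor $\inf\colon\operatorname{rep}(K_s)\to\operatorname{rep}(K_r)$ is $\inf(X)=(X_1,X_2,\psi_{\inf(X)})$ with $\psi_{\inf(X)}(\gamma_i\otimes x)=\psi_X(\gamma_i\otimes x)$ for $i\le s$ and $\psi_{\inf(X)}(\gamma_i\otimes x)=0$ for $i>s$. Both are the identity on morphisms. Here they are used with $s=d+1$, $r=n+1$. Shift functors $\sigma_{K_r},\sigma_{K_r}^{-1}\colon\operatorname{rep}(K_r)\to\operatorname{rep}(K_r)$. $\sigma_{K_r}(M)=(\ker\psi_M,M_1,\psi_{\sigma_{K_r}(M)})$, where $\psi_{\sigma_{K_r}(M)}\colon A_r\otimes\ker\psi_M\to M_1$ is the restriction of $A_r\otimes(A_r\otimes M_1)\to M_1$, $\gamma_i\otimes(\gamma_j\otimes m)\mapsto\delta_{ij}m$; on morphisms $\sigma_{K_r}(f)_1$ is the restriction of $\mathrm{id}_{A_r}\otimes f_1$ and $\sigma_{K_r}(f)_2=f_1$. $\sigma_{K_r}^{-1}(M)=(M_2,\operatorname{coker}\eta_M,\psi_{\sigma^{-1}_{K_r}(M)})$, where $\eta_M\colon M_1\to A_r\otimes M_2$, $m\mapsto\sum_{i=1}^r\gamma_i\otimes\psi_M(\gamma_i\otimes m)$, and $\psi_{\sigma^{-1}_{K_r}(M)}\colon A_r\otimes M_2\to\operatorname{coker}\eta_M$ is the canonical projection; on morphisms $\sigma_{K_r}^{-1}(f)_1=f_2$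 and $\sigma_{K_r}^{-1}(f)_2$ is the map induced by $\mathrm{id}_{A_r}\otimes f_2$ on cokernels. *)

theory Defs
  imports "HOL-Algebra.Algebraic_Closure" "Jordan_Normal_Form.Missing_VectorSpace"
begin

no_notation var (\<open>X\<index>\<close>)

section \<open>Categories, functors, adjunctions\<close>

text \<open>Hom-sets are indexed by their end points and need not be disjoint; accordingly identities,
  composition and the action of a functor on morphisms also take the objects as arguments.
  \<open>Comp C X Y Z g f\<close> is the composite of \<open>f : X \<rightarrow> Y\<close> and \<open>g : Y \<rightarrow> Z\<close>.\<close>

record ('o, 'm) category_data =
  Ob :: "'o set"
  Hom :: "'o \<Rightarrow> 'o \<Rightarrow> 'm set"
  Id :: "'o \<Rightarrow> 'm"
  Comp :: "'o \<Rightarrow> 'o \<Rightarrow> 'o \<Rightarrow> 'm \<Rightarrow> 'm \<Rightarrow> 'm"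

definition is_category :: "('o, 'm) category_data \<Rightarrow> bool" where
  "is_category C \<longleftrightarrow>
     (\<forall>X \<in> Ob C. Id C X \<in> Hom C X X) \<and>
     (\<forall>X \<in> Ob C. \<forall>Y \<in> Ob C. \<forall>Z \<in> Ob C. \<forall>f \<in> Hom C X Y. \<forall>g \<in> Hom C Y Z.
        Comp C X Y Z g f \<in> Hom C X Z) \<and>
     (\<forall>X \<in> Ob C. \<forall>Y \<in> Ob C. \<forall>f \<in> Hom C X Y.
        Comp C X Y Y (Id C Y) f = f \<and> Comp C X X Y f (Id C X) = f) \<and>
     (\<forall>W \<in> Ob C. \<forall>X \<in> Ob C. \<forall>Y \<in> Ob C. \<forall>Z \<in> Ob C.
        \<forall>f \<in> Hom C W X. \<forall>g \<in> Hom C X Y. \<forall>h \<in> Hom C Y Z.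
        Comp C W X Z (Comp C X Y Z h g) f = Comp C W Y Z h (Comp C W X Y g f))"

record ('o1, 'm1, 'o2, 'm2) functor_data =
  omap :: "'o1 \<Rightarrow> 'o2"
  fmap :: "'o1 \<Rightarrow> 'o1 \<Rightarrow> 'm1 \<Rightarrow> 'm2"

definition is_functor ::
  "('o1, 'm1) category_data \<Rightarrow> ('o2, 'm2) category_data \<Rightarrow> ('o1, 'm1, 'o2, 'm2) functor_data \<Rightarrow> bool"
where
  "is_functor C D F \<longleftrightarrow>
     is_category C \<and> is_category D \<and>
     (\<forall>X \<in> Ob C. omap F X \<in> Ob D) \<and>
     (\<forall>X \<in> Ob C. \<forall>Y \<in> Ob C. \<forall>f \<in> Hom C X Y. fmap F X Y f \<in> Hom D (omap F X) (omap F Y)) \<and>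
     (\<forall>X \<in> Ob C. fmap F X X (Id C X) = Id D (omap F X)) \<and>
     (\<forall>X \<in> Ob C. \<forall>Y \<in> Ob C. \<forall>Z \<in> Ob C. \<forall>f \<in> Hom C X Y. \<forall>g \<in> Hom C Y Z.
        fmap F X Z (Comp C X Y Z g f)
          = Comp D (omap F X) (omap F Y) (omap F Z) (fmap F Y Z g) (fmap F X Y f))"

definition fun_comp ::
  "('o2, 'm2, 'o3, 'm3) functor_data \<Rightarrow> ('o1, 'm1, 'o2, 'm2) functor_data
     \<Rightarrow> ('o1, 'm1, 'o3, 'm3) functor_data"  (infixr \<open>\<circ>F\<close> 55)
where
  "G \<circ>F F = \<lparr> omap = (\<lambda>X. omap G (omap F X)),
              fmap = (\<lambda>X Y f. fmap G (omap F X) (omap F Y) (fmap F X Y f)) \<rparr>"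

text \<open>\<open>F : C \<rightarrow> D\<close> is left adjoint to \<open>G : D \<rightarrow> C\<close>: there are bijections
  \<open>D(F X, Y) \<rightarrow> C(X, G Y)\<close> natural in \<open>X\<close> and \<open>Y\<close>.\<close>

definition left_adjoint ::
  "('o1, 'm1) category_data \<Rightarrow> ('o2, 'm2) category_data
     \<Rightarrow> ('o1, 'm1, 'o2, 'm2) functor_data \<Rightarrow> ('o2, 'm2, 'o1, 'm1) functor_data \<Rightarrow> bool"
where
  "left_adjoint C D F G \<longleftrightarrow>
     is_functor C D F \<and> is_functor D C G \<and>
     (\<exists>\<Phi>.
       (\<forall>X \<in> Ob C. \<forall>Y \<in> Ob D.
          bij_betw (\<Phi> X Y) (Hom D (omap F X) Y) (Hom C X (omap G Y))) \<and>
       (\<forall>X \<in> Ob C. \<forall>X' \<in> Ob C. \<forall>Y \<in> Ob D. \<forall>Y' \<in> Ob D.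
          \<forall>u \<in> Hom C X' X. \<forall>v \<in> Hom D Y Y'. \<forall>f \<in> Hom D (omap F X) Y.
          \<Phi> X' Y' (Comp D (omap F X') Y Y' v (Comp D (omap F X') (omap F X) Y f (fmap F X' X u)))
            = Comp C X' (omap G Y) (omap G Y') (fmap G Y Y' v)
                (Comp C X' X (omap G Y) (\<Phi> X Y f) u)))"


section \<open>The universe of vectors and the spaces \<open>A\<^sub>r \<otimes> V\<close>\<close>

text \<open>To have all representations in one type, the carriers of vector spaces are arbitrary sets of
  finite tuple trees with leaves in an arbitrary type \<open>'a\<close>, with arbitrary operations on them. Every
  vector space on a subset of \<open>'a\<close> is thus available (via \<open>Atom\<close>); for \<open>'a\<close> the type of the scalars,
  every finite-dimensional vector space is isomorphic to one in the universe.\<close>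

datatype 'a univ = Atom 'a | Tup (comps: "'a univ list")

type_synonym ('k, 'a) space = "('k, 'a univ) module"

text \<open>As \<open>A\<^sub>r\<close> has the basis \<open>\<gamma>\<^sub>1, \<dots>, \<gamma>\<^sub>r\<close>, the space \<open>A\<^sub>r \<otimes> V\<close> is the direct sum of the \<open>\<gamma>\<^sub>i \<otimes> V\<close>:
  the tuple \<open>Tup [v\<^sub>1, \<dots>, v\<^sub>r]\<close> stands for \<open>\<gamma>\<^sub>1 \<otimes> v\<^sub>1 + \<dots> + \<gamma>\<^sub>r \<otimes> v\<^sub>r\<close>. The fields \<open>mult\<close> and \<open>one\<close> of
  the module record play no role. List positions are counted from 0, so that \<open>arr r V i v\<close> is
  \<open>\<gamma>\<^sub>i\<^sub>+\<^sub>1 \<otimes> v\<close>.\<close>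

definition tens :: "nat \<Rightarrow> ('k, 'a) space \<Rightarrow> ('k, 'a) space" where
  "tens r V =
     \<lparr> carrier = Tup ` {vs. length vs = r \<and> set vs \<subseteq> carrier V},
       monoid.mult = undefined,
       one = undefined,
       zero = Tup (replicate r \<zero>\<^bsub>V\<^esub>),
       add = (\<lambda>x y. Tup (map2 (\<lambda>v w. v \<oplus>\<^bsub>V\<^esub> w) (comps x) (comps y))),
       smult = (\<lambda>a x. Tup (map (\<lambda>v. a \<odot>\<^bsub>V\<^esub> v) (comps x))) \<rparr>"

definition arr :: "nat \<Rightarrow> ('k, 'a) space \<Rightarrow> nat \<Rightarrow> 'a univ \<Rightarrow> 'a univ" where
  "arr r V i v = Tup ((replicate r \<zero>\<^bsub>V\<^esub>)[i := v])"

text \<open>The map \<open>id \<otimes> f\<close>.\<close>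

definition tens_map :: "('a univ \<Rightarrow> 'a univ) \<Rightarrow> 'a univ \<Rightarrow> 'a univ" where
  "tens_map f x = Tup (map f (comps x))"

text \<open>The map \<open>\<iota> \<otimes> id : A\<^sub>s \<otimes> V \<rightarrow> A\<^sub>r \<otimes> V\<close>, and its retraction sending \<open>\<gamma>\<^sub>i \<otimes> v\<close> to 0 for \<open>i > s\<close>.\<close>

definition tens_embed :: "nat \<Rightarrow> nat \<Rightarrow> ('k, 'a) space \<Rightarrow> 'a univ \<Rightarrow> 'a univ" where
  "tens_embed s r V x = Tup (comps x @ replicate (r - s) \<zero>\<^bsub>V\<^esub>)"

definition tens_trunc :: "nat \<Rightarrow> 'a univ \<Rightarrow> 'a univ" where
  "tens_trunc s x = Tup (take s (comps x))"

text \<open>The map \<open>A\<^sub>r \<otimes> (A\<^sub>r \<otimes> V) \<rightarrow> V\<close>, \<open>\<gamma>\<^sub>i \<otimes> (\<gamma>\<^sub>j \<otimes> v) \<mapsto> \<delta>\<^sub>i\<^sub>j v\<close>.\<close>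

definition contraction :: "nat \<Rightarrow> ('k, 'a) space \<Rightarrow> 'a univ \<Rightarrow> 'a univ" where
  "contraction r V x = (\<Oplus>\<^bsub>V\<^esub>i\<in>{..<r}. comps (comps x ! i) ! i)"

lemma tens_map_arr: "f \<zero>\<^bsub>V\<^esub> = \<zero>\<^bsub>W\<^esub> \<Longrightarrow> tens_map f (arr r V i v) = arr r W i (f v)"
  by (simp add: tens_map_def arr_def map_update)

lemma tens_embed_arr: "s \<le> r \<Longrightarrow> i < s \<Longrightarrow> tens_embed s r V (arr s V i v) = arr r V i v"
  by (simp add: tens_embed_def arr_def list_update_append1 [symmetric] replicate_add [symmetric])

lemma tens_trunc_arr:
  assumes "s \<le> r" "i < r"
  shows "tens_trunc s (arr r V i v) = (if i < s then arr s V i v else \<zero>\<^bsub>tens s V\<^esub>)"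
  using assms by (auto simp: tens_trunc_def arr_def tens_def take_update_swap min_def list_update_beyond)

lemma contraction_arr:
  assumes "abelian_group V" "v \<in> carrier V" "i < r" "j < r"
  shows "contraction r V (arr r (tens r V) i (arr r V j v)) = (if i = j then v else \<zero>\<^bsub>V\<^esub>)"
proof -
  interpret abelian_group V by fact
  have "contraction r V (arr r (tens r V) i (arr r V j v))
      = (\<Oplus>\<^bsub>V\<^esub>k\<in>{..<r}. if i = k then (if i = j then v else \<zero>\<^bsub>V\<^esub>) else \<zero>\<^bsub>V\<^esub>)"
    unfolding contraction_def using assms
    by (intro add.finprod_cong') (auto simp: arr_def tens_def nth_list_update)
  also have "\<dots> = (if i = j then v else \<zero>\<^bsub>V\<^esub>)"
    using assms by (intro add.finprod_singleton) auto
  finally show ?thesis .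
qed


section \<open>Cokernels\<close>

text \<open>The quotient of \<open>V\<close> by a subspace \<open>W\<close>, in which each coset is encoded by a chosen element of
  it, so as to remain in the universe; \<open>quot_proj V W\<close> is the canonical projection.\<close>

definition quot_proj :: "('k, 'a) space \<Rightarrow> 'a univ set \<Rightarrow> 'a univ \<Rightarrow> 'a univ" where
  "quot_proj V W x = (SOME y. y \<in> W +>\<^bsub>V\<^esub> x)"

definition quot_space :: "('k, 'a) space \<Rightarrow> 'a univ set \<Rightarrow> ('k, 'a) space" where
  "quot_space V W =
     \<lparr> carrier = quot_proj V W ` carrier V,
       monoid.mult = undefined,
       one = undefined,
       zero = quot_proj V W \<zero>\<^bsub>V\<^esub>,
       add = (\<lambda>x y. quot_proj V W (x \<oplus>\<^bsub>V\<^esub> y)),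
       smult = (\<lambda>a x. quot_proj V W (a \<odot>\<^bsub>V\<^esub> x)) \<rparr>"


section \<open>The category \<open>rep(K\<^sub>r)\<close>\<close>

text \<open>Linear maps are taken to be \<open>undefined\<close> outside their domain, so that equality of morphisms is
  equality of functions on the carriers.\<close>

definition lin_maps ::
  "('k, 'e) ring_scheme \<Rightarrow> ('k, 'a) space \<Rightarrow> ('k, 'a) space \<Rightarrow> ('a univ \<Rightarrow> 'a univ) set"
where
  "lin_maps K V W = module_hom K V W \<inter> extensional (carrier V)"

record ('k, 'a) krep =
  sp1 :: "('k, 'a) space"
  sp2 :: "('k, 'a) space"
  psi :: "'a univ \<Rightarrow> 'a univ"

type_synonym 'a kmor = "('a univ \<Rightarrow> 'a univ) \<times> ('a univ \<Rightarrow> 'a univ)"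

definition is_krep :: "('k, 'e) ring_scheme \<Rightarrow> nat \<Rightarrow> ('k, 'a) krep \<Rightarrow> bool" where
  "is_krep K r M \<longleftrightarrow>
     vectorspace K (sp1 M) \<and> vectorspace.fin_dim K (sp1 M) \<and>
     vectorspace K (sp2 M) \<and> vectorspace.fin_dim K (sp2 M) \<and>
     psi M \<in> lin_maps K (tens r (sp1 M)) (sp2 M)"

definition krep_hom ::
  "('k, 'e) ring_scheme \<Rightarrow> nat \<Rightarrow> ('k, 'a) krep \<Rightarrow> ('k, 'a) krep \<Rightarrow> 'a kmor set"
where
  "krep_hom K r M N =
     {(f1, f2). f1 \<in> lin_maps K (sp1 M) (sp1 N) \<and> f2 \<in> lin_maps K (sp2 M) (sp2 N) \<and>
        (\<forall>x \<in> carrier (tens r (sp1 M)). f2 (psi M x) = psi N (tens_map f1 x))}"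

definition rep_cat ::
  "('k, 'e) ring_scheme \<Rightarrow> nat \<Rightarrow> (('k, 'a) krep, 'a kmor) category_data"
where
  "rep_cat K r =
     \<lparr> Ob = {M. is_krep K r M},
       Hom = krep_hom K r,
       Id = (\<lambda>M. (restrict id (carrier (sp1 M)), restrict id (carrier (sp2 M)))),
       Comp = (\<lambda>L M N (g1, g2) (f1, f2).
                 (compose (carrier (sp1 L)) g1 f1, compose (carrier (sp2 L)) g2 f2)) \<rparr>"


section \<open>Restriction, inflation and the shift functors\<close>

type_synonym ('k, 'a) kfunctor =
  "(('k, 'a) krep, 'a kmor, ('k, 'a) krep, 'a kmor) functor_data"

definition res_functor :: "nat \<Rightarrow> nat \<Rightarrow> ('k, 'a) kfunctor" where
  "res_functor s r =
     \<lparr> omap = (\<lambda>M. \<lparr> sp1 = sp1 M, sp2 = sp2 M,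
                     psi = (\<lambda>x \<in> carrier (tens s (sp1 M)). psi M (tens_embed s r (sp1 M) x)) \<rparr>),
       fmap = (\<lambda>M N f. f) \<rparr>"

definition inf_functor :: "nat \<Rightarrow> nat \<Rightarrow> ('k, 'a) kfunctor" where
  "inf_functor s r =
     \<lparr> omap = (\<lambda>X. \<lparr> sp1 = sp1 X, sp2 = sp2 X,
                     psi = (\<lambda>x \<in> carrier (tens r (sp1 X)). psi X (tens_trunc s x)) \<rparr>),
       fmap = (\<lambda>X Y f. f) \<rparr>"

definition ker_psi :: "nat \<Rightarrow> ('k, 'a) krep \<Rightarrow> ('k, 'a) space" where
  "ker_psi r M = (tens r (sp1 M)) \<lparr> carrier := a_kernel (tens r (sp1 M)) (sp2 M) (psi M) \<rparr>"

definition sigma :: "nat \<Rightarrow> ('k, 'a) kfunctor" where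
  "sigma r =
     \<lparr> omap = (\<lambda>M. \<lparr> sp1 = ker_psi r M, sp2 = sp1 M,
                     psi = restrict (contraction r (sp1 M)) (carrier (tens r (ker_psi r M))) \<rparr>),
       fmap = (\<lambda>M N (f1, f2). (restrict (tens_map f1) (carrier (ker_psi r M)), f1)) \<rparr>"

definition eta :: "nat \<Rightarrow> ('k, 'a) krep \<Rightarrow> 'a univ \<Rightarrow> 'a univ" where
  "eta r M m = Tup (map (\<lambda>i. psi M (arr r (sp1 M) i m)) [0..<r])"

definition eta_proj :: "nat \<Rightarrow> ('k, 'a) krep \<Rightarrow> 'a univ \<Rightarrow> 'a univ" where
  "eta_proj r M = quot_proj (tens r (sp2 M)) (eta r M ` carrier (sp1 M))"

definition coker_eta :: "nat \<Rightarrow> ('k, 'a) krep \<Rightarrow> ('k, 'a) space" where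
  "coker_eta r M = quot_space (tens r (sp2 M)) (eta r M ` carrier (sp1 M))"

text \<open>An element \<open>x\<close> of \<open>coker_eta r M\<close> is a representative of the coset it stands for, so the map
  induced by \<open>id \<otimes> f\<^sub>2\<close> sends it to the class of \<open>(id \<otimes> f\<^sub>2)(x)\<close>.\<close>

definition sigma_inv :: "nat \<Rightarrow> ('k, 'a) kfunctor" where
  "sigma_inv r =
     \<lparr> omap = (\<lambda>M. \<lparr> sp1 = sp2 M, sp2 = coker_eta r M,
                     psi = restrict (eta_proj r M) (carrier (tens r (sp2 M))) \<rparr>),
       fmap = (\<lambda>M N (f1, f2).
                 (f2, \<lambda>x \<in> carrier (coker_eta r M). eta_proj r N (tens_map f2 x))) \<rparr>"

end

theory Submission
  imports Defs
begin

text \<open>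
  A morphism \<open>\<sigma>\<^sup>-\<^sup>1 P \<rightarrow> Y\<close> is determined by its first component \<open>g : P\<^sub>2 \<rightarrow> Y\<^sub>1\<close>, and \<open>g\<close> occurs iff
  \<open>\<psi>\<^sub>Y \<circ> (id \<otimes> g) \<circ> \<eta>\<^sub>P = 0\<close>. A morphism \<open>X \<rightarrow> \<sigma> Q\<close> is determined by its second component
  \<open>g : X\<^sub>2 \<rightarrow> Q\<^sub>1\<close>, its first component being \<open>(id \<otimes> g) \<circ> \<eta>\<^sub>X\<close>, and \<open>g\<close> occurs iff
  \<open>\<psi>\<^sub>Q \<circ> (id \<otimes> g) \<circ> \<eta>\<^sub>X = 0\<close>. For \<open>P = inf X\<close>, \<open>Q = res Y\<close>, and likewise for \<open>P = res X\<close>,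
  \<open>Q = inf Y\<close>, the two conditions on \<open>g\<close> are the same, since in both of them only the arrows common
  to the two quivers contribute.
\<close>

section \<open>Linear maps, subspaces and finite dimension\<close>

lemma module_homI:
  assumes "\<And>x. x \<in> carrier V \<Longrightarrow> f x \<in> carrier W"
    and "\<And>x y. x \<in> carrier V \<Longrightarrow> y \<in> carrier V \<Longrightarrow> f (x \<oplus>\<^bsub>V\<^esub> y) = f x \<oplus>\<^bsub>W\<^esub> f y"
    and "\<And>a x. a \<in> carrier K \<Longrightarrow> x \<in> carrier V \<Longrightarrow> f (a \<odot>\<^bsub>V\<^esub> x) = a \<odot>\<^bsub>W\<^esub> f x"
  shows "f \<in> module_hom K V W"
  using assms by (auto simp: module_hom_def)

lemma module_hom_in: "f \<in> module_hom K V W \<Longrightarrow> x \<in> carrier V \<Longrightarrow> f x \<in> carrier W"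
  by (auto simp: module_hom_def)

lemma linear_mapI:
  "vectorspace K V \<Longrightarrow> vectorspace K W \<Longrightarrow> f \<in> module_hom K V W \<Longrightarrow> linear_map K V W f"
  by (simp add: linear_map_def mod_hom_def mod_hom_axioms_def vectorspace_def)

lemma module_hom_zero:
  assumes "vectorspace K V" "vectorspace K W" "f \<in> module_hom K V W"
  shows "f \<zero>\<^bsub>V\<^esub> = \<zero>\<^bsub>W\<^esub>"
proof -
  interpret linear_map K V W f using assms by (rule linear_mapI)
  show ?thesis by simp
qed

lemma module_hom_finsum:
  assumes "vectorspace K V" "vectorspace K W" "f \<in> module_hom K V W"
    and "finite I" "\<And>i. i \<in> I \<Longrightarrow> g i \<in> carrier V"
  shows "f (finsum V g I) = finsum W (\<lambda>i. f (g i)) I"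
proof -
  interpret linear_map K V W f using assms(1-3) by (rule linear_mapI)
  from assms(4,5) show ?thesis
    by (induction I rule: finite_induct) (auto simp: Pi_def)
qed

lemma module_hom_subset:
  assumes "f \<in> module_hom K V W" "carrier V' \<subseteq> carrier V" "add V' = add V" "smult V' = smult V"
  shows "f \<in> module_hom K V' W"
  using assms by (auto simp: module_hom_def Pi_def subset_iff)

lemma module_hom_comp:
  "f \<in> module_hom K U V \<Longrightarrow> g \<in> module_hom K V W \<Longrightarrow> (\<lambda>x. g (f x)) \<in> module_hom K U W"
  by (auto simp: module_hom_def Pi_def)

lemma module_hom_cong:
  assumes "vectorspace K V" "\<And>x. x \<in> carrier V \<Longrightarrow> f x = g x"
  shows "f \<in> module_hom K V W \<longleftrightarrow> g \<in> module_hom K V W"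
proof -
  interpret vectorspace K V by fact
  have *: "f' \<in> module_hom K V W \<Longrightarrow> (\<And>x. x \<in> carrier V \<Longrightarrow> f' x = g' x) \<Longrightarrow> g' \<in> module_hom K V W"
    for f' g' by (auto simp: module_hom_def Pi_def)
  show ?thesis using *[of f g] *[of g f] assms(2) by auto
qed

lemma linear_map_ker_subspace:
  assumes "vectorspace K V" "vectorspace K W" "f \<in> module_hom K V W"
  shows "subspace K {x \<in> carrier V. f x = \<zero>\<^bsub>W\<^esub>} V"
proof -
  interpret linear_map K V W f using assms by (rule linear_mapI)
  show ?thesis using kerT_is_subspace by (simp add: ker_def)
qed

lemma linear_map_image_subspace:
  assumes "vectorspace K V" "vectorspace K W" "f \<in> module_hom K V W"
  shows "subspace K (f ` carrier V) W"
proof -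
  interpret linear_map K V W f using assms by (rule linear_mapI)
  show ?thesis using imT_is_subspace by (simp add: im_def)
qed

text \<open>Serves to pass from generators to a whole space: in \<open>fin_dim_tens\<close> it is
  applied to the map \<open>arr r V i\<close>, and a preimage that contains generators of
  \<open>V\<close> must be all of \<open>V\<close>.\<close>

lemma submodule_vimage:
  assumes "vectorspace K U" "vectorspace K V" "f \<in> module_hom K U V" "submodule K N V"
  shows "submodule K {x \<in> carrier U. f x \<in> N} U"
proof -
  interpret linear_map K U V f using assms(1-3) by (rule linear_mapI)
  have U: "module K U" by unfold_locales
  show ?thesis
    using submodule.m_closed[OF assms(4)] submodule.zero_closed[OF assms(4)]
      submodule.smult_closed[OF assms(4)]
    by (intro submodule.intro[OF U]) auto
qed

lemma submodule_finsum:
  assumes "submodule K N V" "finite I" "\<And>i. i \<in> I \<Longrightarrow> f i \<in> N"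
  shows "finsum V f I \<in> N"
proof -
  interpret N: submodule K N V by fact
  interpret module K V by (rule N.module)
  from assms(2,3) show ?thesis
  proof (induction I rule: finite_induct)
    case (insert i I)
    then have "f \<in> I \<rightarrow> carrier V" "f i \<in> carrier V" using N.subset by auto
    with insert show ?case by (simp add: N.m_closed)
  qed simp
qed

section \<open>Finite dimension of subspaces and by generators\<close>

lemma (in vectorspace) fin_dim_subspace:
  assumes "fin_dim" "subspace K W V"
  shows "vectorspace.fin_dim K (vs W)"
proof -
  interpret W: vectorspace K "vs W" using assms(2) by (rule subspace_is_vs)
  have sub: "submodule K W V" using assms(2) by simp
  have WV: "W \<subseteq> carrier V" using sub by (rule submodule.subset)
  let ?P = "\<lambda>S. S \<subseteq> carrier (vs W) \<and> W.lin_indpt S"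
  \<comment> \<open>Independence in \<open>vs W\<close> implies independence in \<open>V\<close>, so
    \<open>dim\<close> bounds the size of independent subsets of \<open>W\<close>. Starting from the
    empty set, a maximal one exists, and it is a finite basis of \<open>vs W\<close>.\<close>
  have bound: "finite A \<and> card A \<le> dim" if "?P A" for A
    using that li_le_dim[OF assms(1), of A] WV span_li_not_depend(2)[OF _ sub, of A] by auto
  have empty: "?P {}" by (auto simp: W.lin_dep_def)
  obtain A where "finite A" "maximal A ?P"
    using maximal_exists[of ?P, OF bound empty] by blast
  from W.max_li_is_basis[OF this(2)] this(1) show ?thesis
    unfolding W.fin_dim_def W.basis_def by blast
qed

text \<open>Finite generation is phrased through submodules instead of spans, so that generators are
  tested by closure properties and no linear combinations have to be written.
  \<open>fin_dimE\<close> is the converse.\<close>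

lemma (in vectorspace) fin_dimI:
  assumes "finite B" "B \<subseteq> carrier V"
    and "\<And>N. submodule K N V \<Longrightarrow> B \<subseteq> N \<Longrightarrow> carrier V \<subseteq> N"
  shows "fin_dim"
proof -
  have "carrier V \<subseteq> span B"
    using assms(2) by (intro assms(3) span_is_submodule in_own_span)
  then show ?thesis using assms(1,2) span_is_subset2[of B] by (auto simp: fin_dim_def)
qed

lemma (in vectorspace) fin_dimE:
  assumes "fin_dim"
  obtains B where "finite B" "B \<subseteq> carrier V"
    "\<And>N. submodule K N V \<Longrightarrow> B \<subseteq> N \<Longrightarrow> carrier V \<subseteq> N"
proof -
  from assms obtain B where B: "finite B" "B \<subseteq> carrier V" "span B = carrier V"
    by (auto simp: fin_dim_def)
  show ?thesis using B span_is_subset[of B] by (intro that[of B]) auto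
qed

lemma lin_mapsD:
  assumes "f \<in> lin_maps K V W"
  shows "f \<in> module_hom K V W" "f \<in> extensional (carrier V)"
  using assms by (auto simp: lin_maps_def)

lemma restrict_lin_maps:
  assumes "vectorspace K V" "f \<in> module_hom K V W"
  shows "restrict f (carrier V) \<in> lin_maps K V W"
  using assms(2) module_hom_cong[OF assms(1), of f "restrict f (carrier V)" W]
  by (simp add: lin_maps_def)

lemma compose_lin_maps:
  assumes "vectorspace K U" "f \<in> lin_maps K U V" "g \<in> lin_maps K V W"
  shows "compose (carrier U) g f \<in> lin_maps K U W"
  using restrict_lin_maps[OF assms(1) module_hom_comp[OF assms(2,3)[THEN lin_mapsD(1)]]]
  by (simp add: compose_def)


section \<open>The spaces \<open>A\<^sub>r \<otimes> V\<close>\<close>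

text \<open>The clause with \<open>vs\<close> excludes atoms, on which the selector
  \<open>comps\<close> is unspecified. With it, all later work can be done coordinate by
  coordinate.\<close>

lemma tens_carrier_iff:
  "x \<in> carrier (tens r V) \<longleftrightarrow>
     (\<exists>vs. x = Tup vs) \<and> length (comps x) = r \<and> (\<forall>i<r. comps x ! i \<in> carrier V)"
  by (auto simp: tens_def in_set_conv_nth subset_iff image_iff)

lemma tens_carrierD:
  assumes "x \<in> carrier (tens r V)"
  shows "length (comps x) = r" "i < r \<Longrightarrow> comps x ! i \<in> carrier V"
  using assms by (auto simp: tens_carrier_iff)

lemma tens_eqI:
  assumes "x \<in> carrier (tens r V)" "y \<in> carrier (tens r W)"
    and "\<And>i. i < r \<Longrightarrow> comps x ! i = comps y ! i"
  shows "x = y"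
  using assms nth_equalityI[of "comps x" "comps y"] by (auto simp: tens_carrier_iff)

lemma Tup_map_in_tens:
  "(\<And>i. i < r \<Longrightarrow> f i \<in> carrier V) \<Longrightarrow> Tup (map f [0..<r]) \<in> carrier (tens r V)"
  by (auto simp: tens_carrier_iff)

lemma tens_zero_nth: "i < r \<Longrightarrow> comps \<zero>\<^bsub>tens r V\<^esub> ! i = \<zero>\<^bsub>V\<^esub>"
  by (simp add: tens_def)

lemma tens_add_nth:
  assumes "x \<in> carrier (tens r V)" "y \<in> carrier (tens r V)" "i < r"
  shows "comps (x \<oplus>\<^bsub>tens r V\<^esub> y) ! i = comps x ! i \<oplus>\<^bsub>V\<^esub> comps y ! i"
  using assms by (auto simp: tens_carrier_iff) (auto simp: tens_def)

lemma tens_smult_nth: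
  assumes "x \<in> carrier (tens r V)" "i < r"
  shows "comps (a \<odot>\<^bsub>tens r V\<^esub> x) ! i = a \<odot>\<^bsub>V\<^esub> (comps x ! i)"
  using assms by (auto simp: tens_carrier_iff) (auto simp: tens_def)

lemma tens_add_closed:
  assumes "\<And>u v. u \<in> carrier V \<Longrightarrow> v \<in> carrier V \<Longrightarrow> u \<oplus>\<^bsub>V\<^esub> v \<in> carrier V"
    and "x \<in> carrier (tens r V)" "y \<in> carrier (tens r V)"
  shows "x \<oplus>\<^bsub>tens r V\<^esub> y \<in> carrier (tens r V)"
  using assms by (auto simp: tens_carrier_iff) (auto simp: tens_def)

lemma tens_smult_closed:
  assumes "\<And>u. u \<in> carrier V \<Longrightarrow> a \<odot>\<^bsub>V\<^esub> u \<in> carrier V" "x \<in> carrier (tens r V)"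
  shows "a \<odot>\<^bsub>tens r V\<^esub> x \<in> carrier (tens r V)"
  using assms by (auto simp: tens_carrier_iff) (auto simp: tens_def)

lemma tens_map_nth:
  "x \<in> carrier (tens r V) \<Longrightarrow> i < r \<Longrightarrow> comps (tens_map f x) ! i = f (comps x ! i)"
  by (auto simp: tens_carrier_iff tens_map_def)

lemma arr_nth: "i < r \<Longrightarrow> j < r \<Longrightarrow> comps (arr r V i v) ! j = (if i = j then v else \<zero>\<^bsub>V\<^esub>)"
  by (simp add: arr_def nth_list_update)

lemmas tens_nth = tens_zero_nth tens_add_nth tens_smult_nth tens_map_nth arr_nth tens_carrierD(2)

lemma tens_zero_closed: "\<zero>\<^bsub>V\<^esub> \<in> carrier V \<Longrightarrow> \<zero>\<^bsub>tens r V\<^esub> \<in> carrier (tens r V)"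
  by (auto simp: tens_carrier_iff) (auto simp: tens_def)

lemma arr_closed: "\<zero>\<^bsub>V\<^esub> \<in> carrier V \<Longrightarrow> v \<in> carrier V \<Longrightarrow> arr r V i v \<in> carrier (tens r V)"
  by (auto simp: tens_carrier_iff arr_def)
    (metis length_replicate nth_list_update_eq nth_list_update_neq nth_replicate)

text \<open>Asks only for closure under \<open>f\<close>, so that it applies to negation on
  \<open>V\<close> and to maps between kernels without a linearity proof.\<close>

lemma tens_map_closed:
  assumes "\<And>v. v \<in> carrier V \<Longrightarrow> f v \<in> carrier W" "x \<in> carrier (tens r V)"
  shows "tens_map f x \<in> carrier (tens r W)"
  using assms by (auto simp: tens_carrier_iff tens_map_def)

text \<open>By \<open>tens_eqI\<close> each equational axiom reduces to the same axiom of
  \<open>V\<close> in every coordinate. The existence of negatives is treated apart, with the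
  coordinatewise negative as witness.\<close>

lemma vectorspace_tens:
  assumes "vectorspace K V"
  shows "vectorspace K (tens r V)"
proof -
  interpret vectorspace K V by fact
  note [simp] = tens_add_closed[where r = r and V = V] tens_smult_closed[where r = r and V = V]
    tens_zero_closed tens_nth[where r = r and V = V]
  have neg: "\<exists>y \<in> carrier (tens r V). x \<oplus>\<^bsub>tens r V\<^esub> y = \<zero>\<^bsub>tens r V\<^esub>"
    if x: "x \<in> carrier (tens r V)" for x
  proof -
    have y: "tens_map (\<lambda>v. \<ominus>\<^bsub>V\<^esub> v) x \<in> carrier (tens r V)"
      using x by (rule tens_map_closed[rotated]) simp
    have "x \<oplus>\<^bsub>tens r V\<^esub> tens_map (\<lambda>v. \<ominus>\<^bsub>V\<^esub> v) x = \<zero>\<^bsub>tens r V\<^esub>"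
      using x y by (rule_tac tens_eqI[of _ r V _ V]) (simp_all add: M.r_neg)
    with y show ?thesis by blast
  qed
  show ?thesis
    by (rule vs_criteria; (intro allI ballI impI)?; (elim conjE)?;
        (rule field_axioms | erule neg | (rule tens_eqI[of _ r V _ V]; simp add: M.a_ac
          smult_assoc1 smult_l_distr smult_r_distr) | simp))
qed

lemma arr_module_hom:
  assumes "vectorspace K V" "i < r"
  shows "arr r V i \<in> module_hom K V (tens r V)"
proof -
  interpret vectorspace K V by fact
  note [simp] = tens_add_closed[where r = r and V = V] tens_smult_closed[where r = r and V = V]
    tens_zero_closed tens_nth[where r = r and V = V] arr_closed
  show ?thesis
    by (rule module_homI; (rule tens_eqI[of _ r V _ V])?; simp add: assms(2))
qed

lemma tens_map_module_hom:
  assumes "vectorspace K V" "f \<in> module_hom K V W"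
  shows "tens_map f \<in> module_hom K (tens r V) (tens r W)"
proof (rule module_homI)
  interpret V: vectorspace K V by fact
  interpret T: vectorspace K "tens r V" using assms(1) by (rule vectorspace_tens)
  note cl = tens_map_closed[OF module_hom_in[OF assms(2)]]
  show "x \<in> carrier (tens r V) \<Longrightarrow> tens_map f x \<in> carrier (tens r W)" for x by (rule cl)
  have set_D: "x \<in> carrier V" if "v \<in> carrier (tens r V)" "x \<in> set (comps v)" for v x
    using that by (auto simp: tens_carrier_iff in_set_conv_nth)
  show "tens_map f (x \<oplus>\<^bsub>tens r V\<^esub> y) = tens_map f x \<oplus>\<^bsub>tens r W\<^esub> tens_map f y"
    if "x \<in> carrier (tens r V)" "y \<in> carrier (tens r V)" for x y
    using set_D[OF that(1)] set_D[OF that(2)] module_hom_add[OF assms(2)]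
    by (auto simp: tens_def tens_map_def zip_map_map elim!: in_set_zipE
        intro!: nth_equalityI)
  show "tens_map f (a \<odot>\<^bsub>tens r V\<^esub> x) = a \<odot>\<^bsub>tens r W\<^esub> tens_map f x"
    if "a \<in> carrier K" "x \<in> carrier (tens r V)" for a x
    using set_D[OF that(2)] that(1) module_hom_smult[OF assms(2)] by (simp add: tens_def tens_map_def)
qed

lemma tens_map_in:
  assumes "f \<in> module_hom K V W" "x \<in> carrier (tens r V)"
  shows "tens_map f x \<in> carrier (tens r W)"
  using assms(2) by (rule tens_map_closed[rotated]) (rule module_hom_in[OF assms(1)])

lemma tens_map_id: "x \<in> carrier (tens r V) \<Longrightarrow> tens_map (restrict id (carrier V)) x = x"
  by (auto simp: tens_map_def tens_carrier_iff in_set_conv_nth intro!: map_idI)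

lemma tens_map_compose:
  "x \<in> carrier (tens r V) \<Longrightarrow> tens_map (compose (carrier V) g f) x = tens_map g (tens_map f x)"
  by (auto simp: tens_map_def tens_carrier_iff in_set_conv_nth compose_eq)

lemma tens_embed_module_hom:
  assumes "vectorspace K V" "s \<le> r"
  shows "tens_embed s r V \<in> module_hom K (tens s V) (tens r V)"
proof -
  interpret V: vectorspace K V by fact
  show ?thesis
    using assms(2) by (intro module_homI)
      (auto simp: tens_embed_def tens_def map2_map_map intro!: imageI)
qed

lemma tens_trunc_module_hom:
  assumes "s \<le> r"
  shows "tens_trunc s \<in> module_hom K (tens r V) (tens s V)"
  using assms by (intro module_homI)
    (auto simp: tens_trunc_def tens_def take_map take_zip dest!: in_set_takeD)

lemma tens_map_embed:
  "f \<zero>\<^bsub>V\<^esub> = \<zero>\<^bsub>W\<^esub> \<Longrightarrow> tens_map f (tens_embed s r V x) = tens_embed s r W (tens_map f x)"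
  by (simp add: tens_map_def tens_embed_def)

lemma tens_map_trunc: "tens_map f (tens_trunc s x) = tens_trunc s (tens_map f x)"
  by (simp add: tens_map_def tens_trunc_def take_map)

text \<open>Reduces questions about linear maps on \<open>tens r V\<close> to the simple tensors
  \<open>arr r V i v\<close>.\<close>

lemma tens_expand:
  assumes "vectorspace K V" "x \<in> carrier (tens r V)"
  shows "x = (\<Oplus>\<^bsub>tens r V\<^esub>i\<in>{..<r}. arr r V i (comps x ! i))"
proof -
  interpret V: vectorspace K V by fact
  interpret T: vectorspace K "tens r V" using assms(1) by (rule vectorspace_tens)
  note nth = tens_nth[where r = r and V = V]
  have arr: "arr r V i (comps x ! i) \<in> carrier (tens r V)" if "i < r" for i
    using that assms(2) by (intro arr_closed) (simp_all add: nth)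
  show ?thesis
  proof (rule tens_eqI[OF assms(2)])
    show "(\<Oplus>\<^bsub>tens r V\<^esub>i\<in>{..<r}. arr r V i (comps x ! i)) \<in> carrier (tens r V)"
      using arr by (intro T.M.finsum_closed) auto
    fix j assume j: "j < r"
    \<comment> \<open>The \<open>j\<close>-th coordinate is a linear map, hence commutes with the
      sum, in which only the summand with index \<open>j\<close> survives.\<close>
    have hom: "(\<lambda>y. comps y ! j) \<in> module_hom K (tens r V) V"
      by (rule module_homI) (simp_all add: j nth)
    have "comps (\<Oplus>\<^bsub>tens r V\<^esub>i\<in>{..<r}. arr r V i (comps x ! i)) ! j
        = (\<Oplus>\<^bsub>V\<^esub>i\<in>{..<r}. comps (arr r V i (comps x ! i)) ! j)"
      using arr by (intro module_hom_finsum[OF T.vectorspace_axioms assms(1) hom]) auto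
    also have "\<dots> = (\<Oplus>\<^bsub>V\<^esub>i\<in>{..<r}. if j = i then comps x ! i else \<zero>\<^bsub>V\<^esub>)"
      using assms(2) j by (intro V.M.finsum_cong') (auto simp: nth)
    also have "\<dots> = comps x ! j"
      using assms(2) j by (intro V.M.add.finprod_singleton) (auto simp: nth)
    finally show "comps x ! j = comps (\<Oplus>\<^bsub>tens r V\<^esub>i\<in>{..<r}. arr r V i (comps x ! i)) ! j" by simp
  qed
qed

text \<open>Generators are the \<open>arr r V i b\<close> with \<open>b\<close> in a finite
  generating set of \<open>V\<close>.\<close>

lemma fin_dim_tens:
  assumes "vectorspace K V" "vectorspace.fin_dim K V"
  shows "vectorspace.fin_dim K (tens r V)"
proof -
  interpret V: vectorspace K V by fact
  interpret T: vectorspace K "tens r V" using assms(1) by (rule vectorspace_tens)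
  note tn = tens_nth[where r = r and V = V]
  obtain B where B: "finite B" "B \<subseteq> carrier V"
    "\<And>N. submodule K N V \<Longrightarrow> B \<subseteq> N \<Longrightarrow> carrier V \<subseteq> N"
    using V.fin_dimE[OF assms(2)] by blast
  show ?thesis
  proof (rule T.fin_dimI[of "\<Union>i<r. arr r V i ` B"])
    show "(\<Union>i<r. arr r V i ` B) \<subseteq> carrier (tens r V)"
      using B(2) by (auto intro!: arr_closed)
    fix N assume N: "submodule K N (tens r V)" and sub: "(\<Union>i<r. arr r V i ` B) \<subseteq> N"
    have arr_N: "arr r V i v \<in> N" if "i < r" "v \<in> carrier V" for i v
    proof -
      \<comment> \<open>For fixed \<open>i\<close>, the vectors \<open>v\<close> whose simple tensor
        lies in \<open>N\<close> form a submodule of \<open>V\<close> containing \<open>B\<close>,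
        hence all of \<open>V\<close>.\<close>
      have "submodule K {v \<in> carrier V. arr r V i v \<in> N} V"
        using that(1) by (intro submodule_vimage[OF assms(1) T.vectorspace_axioms _ N]
            arr_module_hom assms(1))
      moreover have "B \<subseteq> {v \<in> carrier V. arr r V i v \<in> N}" using sub B(2) that(1) by auto
      ultimately show ?thesis using B(3) that(2) by blast
    qed
    show "carrier (tens r V) \<subseteq> N"
    proof
      fix x assume x: "x \<in> carrier (tens r V)"
      have "(\<Oplus>\<^bsub>tens r V\<^esub>i\<in>{..<r}. arr r V i (comps x ! i)) \<in> N"
        using x by (intro submodule_finsum[OF N] arr_N) (auto simp: tn)
      then show "x \<in> N" using tens_expand[OF assms(1) x] by simp
    qed
  qed (use B in auto)
qed


section \<open>Cokernels and the maps \<open>\<eta>\<close> and contraction\<close>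

locale subspace_quotient = vectorspace K V + W: submodule K W V for K and V :: "('k, 'a) space" and W
begin

abbreviation "p \<equiv> quot_proj V W"
abbreviation "Q \<equiv> quot_space V W"

lemma mem_coset_iff: "y \<in> W +>\<^bsub>V\<^esub> x \<longleftrightarrow> (\<exists>w\<in>W. y = w \<oplus>\<^bsub>V\<^esub> x)"
  by (simp add: a_r_coset_def')

text \<open>The choice operator enters through two facts only: here, a representative stays in its
  coset; in \<open>proj_add_left\<close>, equal cosets have equal representatives.\<close>

lemma proj_mem:
  assumes "x \<in> carrier V"
  obtains w where "w \<in> W" "p x = w \<oplus>\<^bsub>V\<^esub> x"
proof -
  have "x \<in> W +>\<^bsub>V\<^esub> x"
    unfolding mem_coset_iff by (intro bexI[of _ "\<zero>\<^bsub>V\<^esub>"]) (simp_all add: assms)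
  then have "p x \<in> W +>\<^bsub>V\<^esub> x" unfolding quot_proj_def by (rule someI)
  then show ?thesis using that unfolding mem_coset_iff by blast
qed

lemma W_carrier: "w \<in> W \<Longrightarrow> w \<in> carrier V"
  using W.subset by blast

text \<open>A submodule is closed under scalars, in particular under -1.\<close>

lemma W_minus: "w \<in> W \<Longrightarrow> \<ominus>\<^bsub>V\<^esub> w \<in> W"
  using W.smult_closed[of "\<ominus>\<^bsub>K\<^esub> \<one>\<^bsub>K\<^esub>" w] W_carrier by (simp add: smult_minus_1)

text \<open>Translation by an element of \<open>W\<close> does not change the coset, and
  \<open>p\<close> depends on the coset alone.\<close>

lemma proj_add_left:
  assumes "w \<in> W" "x \<in> carrier V"
  shows "p (w \<oplus>\<^bsub>V\<^esub> x) = p x"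
proof -
  have "W +>\<^bsub>V\<^esub> (w \<oplus>\<^bsub>V\<^esub> x) = W +>\<^bsub>V\<^esub> x"
  proof (intro equalityI subsetI)
    fix y assume "y \<in> W +>\<^bsub>V\<^esub> (w \<oplus>\<^bsub>V\<^esub> x)"
    then obtain v where v: "v \<in> W" "y = v \<oplus>\<^bsub>V\<^esub> (w \<oplus>\<^bsub>V\<^esub> x)" unfolding mem_coset_iff by blast
    then have "y = (v \<oplus>\<^bsub>V\<^esub> w) \<oplus>\<^bsub>V\<^esub> x" using assms by (simp add: M.a_assoc W_carrier)
    then show "y \<in> W +>\<^bsub>V\<^esub> x" using v(1) assms(1) W.m_closed unfolding mem_coset_iff by blast
  next
    fix y assume "y \<in> W +>\<^bsub>V\<^esub> x"
    then obtain v where v: "v \<in> W" "y = v \<oplus>\<^bsub>V\<^esub> x" unfolding mem_coset_iff by blast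
    then have "y = (v \<oplus>\<^bsub>V\<^esub> \<ominus>\<^bsub>V\<^esub> w) \<oplus>\<^bsub>V\<^esub> (w \<oplus>\<^bsub>V\<^esub> x)"
      using assms by (simp add: M.a_assoc W_carrier M.r_neg1)
    moreover have "v \<oplus>\<^bsub>V\<^esub> \<ominus>\<^bsub>V\<^esub> w \<in> W" using v(1) assms(1) W_minus by blast
    ultimately show "y \<in> W +>\<^bsub>V\<^esub> (w \<oplus>\<^bsub>V\<^esub> x)" unfolding mem_coset_iff by blast
  qed
  then show ?thesis by (simp add: quot_proj_def)
qed

lemma proj_closed [simp]: "x \<in> carrier V \<Longrightarrow> p x \<in> carrier V"
  by (rule proj_mem[of x]) (auto simp: W_carrier)

lemma proj_proj [simp]: "x \<in> carrier V \<Longrightarrow> p (p x) = p x"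
  by (rule proj_mem[of x]) (auto simp: proj_add_left)

text \<open>Replacing the summands by representatives changes the sum by an element of
  \<open>W\<close>, which the outer \<open>p\<close> absorbs.\<close>

lemma proj_add:
  assumes "x \<in> carrier V" "y \<in> carrier V"
  shows "p (p x \<oplus>\<^bsub>V\<^esub> p y) = p (x \<oplus>\<^bsub>V\<^esub> y)"
proof -
  obtain v w where vw: "v \<in> W" "p x = v \<oplus>\<^bsub>V\<^esub> x" "w \<in> W" "p y = w \<oplus>\<^bsub>V\<^esub> y"
    using proj_mem assms by metis
  then have "p x \<oplus>\<^bsub>V\<^esub> p y = (v \<oplus>\<^bsub>V\<^esub> w) \<oplus>\<^bsub>V\<^esub> (x \<oplus>\<^bsub>V\<^esub> y)"
    using assms by (simp add: M.a_ac W_carrier)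
  then show ?thesis using vw assms by (simp add: proj_add_left)
qed

lemma proj_smult:
  assumes "a \<in> carrier K" "x \<in> carrier V"
  shows "p (a \<odot>\<^bsub>V\<^esub> p x) = p (a \<odot>\<^bsub>V\<^esub> x)"
proof -
  obtain w where w: "w \<in> W" "p x = w \<oplus>\<^bsub>V\<^esub> x" using proj_mem assms by metis
  then have "a \<odot>\<^bsub>V\<^esub> p x = a \<odot>\<^bsub>V\<^esub> w \<oplus>\<^bsub>V\<^esub> a \<odot>\<^bsub>V\<^esub> x"
    using assms by (simp add: smult_r_distr W_carrier)
  then show ?thesis using w assms by (simp add: proj_add_left)
qed

lemma carrier_quot: "carrier Q = p ` carrier V"
  by (simp add: quot_space_def)

lemma proj_in_quot: "x \<in> carrier V \<Longrightarrow> p x \<in> carrier Q"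
  by (simp add: carrier_quot)

lemma quot_in_carrier: "x \<in> carrier Q \<Longrightarrow> x \<in> carrier V"
  by (auto simp: carrier_quot)

lemma proj_quot: "x \<in> carrier Q \<Longrightarrow> p x = x"
  by (auto simp: carrier_quot)

lemma quot_add: "x \<in> carrier V \<Longrightarrow> y \<in> carrier V \<Longrightarrow> p x \<oplus>\<^bsub>Q\<^esub> p y = p (x \<oplus>\<^bsub>V\<^esub> y)"
  by (simp add: quot_space_def proj_add)

lemma quot_smult: "a \<in> carrier K \<Longrightarrow> x \<in> carrier V \<Longrightarrow> a \<odot>\<^bsub>Q\<^esub> p x = p (a \<odot>\<^bsub>V\<^esub> x)"
  by (simp add: quot_space_def proj_smult)

lemma quot_zero: "\<zero>\<^bsub>Q\<^esub> = p \<zero>\<^bsub>V\<^esub>"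
  by (simp add: quot_space_def)

text \<open>Every element of \<open>Q\<close> has the form \<open>p x\<close>, and \<open>p\<close>
  carries the operations of \<open>V\<close> to those of \<open>Q\<close>, so the axioms descend
  from \<open>V\<close>.\<close>

lemma vectorspace_quot: "vectorspace K Q"
proof -
  have neg: "\<exists>y \<in> carrier Q. x \<oplus>\<^bsub>Q\<^esub> y = \<zero>\<^bsub>Q\<^esub>" if "x \<in> carrier Q" for x
  proof -
    from that have x: "x \<in> carrier V" "p x = x" by (auto simp: quot_in_carrier proj_quot)
    have "x \<oplus>\<^bsub>Q\<^esub> p (\<ominus>\<^bsub>V\<^esub> x) = \<zero>\<^bsub>Q\<^esub>"
      using quot_add[of x "\<ominus>\<^bsub>V\<^esub> x"] x by (simp add: M.r_neg quot_zero)
    then show ?thesis using x(1) by (auto intro: proj_in_quot)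
  qed
  show ?thesis
    by (rule vs_criteria)
      (use neg in \<open>auto simp: field_axioms carrier_quot quot_add quot_smult quot_zero M.a_ac
         smult_assoc1 smult_l_distr smult_r_distr\<close>)
qed

lemma proj_hom: "p \<in> module_hom K V Q"
  by (rule module_homI) (auto simp: proj_in_quot quot_add quot_smult)

lemma fin_dim_quot: "fin_dim \<Longrightarrow> vectorspace.fin_dim K Q"
  using linear_map.surj_fin_dim[OF linear_mapI[OF vectorspace_axioms vectorspace_quot proj_hom]]
  by (simp add: carrier_quot)

lemma proj_W: "w \<in> W \<Longrightarrow> p w = \<zero>\<^bsub>Q\<^esub>"
  using proj_add_left[of w "\<zero>\<^bsub>V\<^esub>"] W_carrier by (simp add: quot_zero)

context
  fixes Z g
  assumes Z: "vectorspace K Z" and g: "g \<in> module_hom K V Z"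
    and g_W: "\<And>w. w \<in> W \<Longrightarrow> g w = \<zero>\<^bsub>Z\<^esub>"
begin

text \<open>The representative differs from \<open>x\<close> by an element of \<open>W\<close>,
  which \<open>g\<close> kills. This is well-definedness of the map induced on the quotient.\<close>

lemma hom_proj: "x \<in> carrier V \<Longrightarrow> g (p x) = g x"
proof -
  interpret Z: vectorspace K Z by (rule Z)
  assume x: "x \<in> carrier V"
  obtain w where w: "w \<in> W" "p x = w \<oplus>\<^bsub>V\<^esub> x" using proj_mem[OF x] by metis
  then show ?thesis
    using module_hom_add[OF g W_carrier x, of w] module_hom_in[OF g x] g_W[of w] by simp
qed

text \<open>As the elements of \<open>Q\<close> are representatives of cosets, the map induced by \<open>g\<close> is \<open>g\<close> itself.\<close>

lemma hom_quot: "g \<in> module_hom K Q Z"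
proof (rule module_homI)
  show "g (x \<oplus>\<^bsub>Q\<^esub> y) = g x \<oplus>\<^bsub>Z\<^esub> g y" if "x \<in> carrier Q" "y \<in> carrier Q" for x y
    using that hom_proj[of "x \<oplus>\<^bsub>V\<^esub> y"] module_hom_add[OF g, of x y]
    by (simp add: quot_space_def[of V W] quot_in_carrier)
  show "g (a \<odot>\<^bsub>Q\<^esub> x) = a \<odot>\<^bsub>Z\<^esub> g x" if "a \<in> carrier K" "x \<in> carrier Q" for a x
    using that hom_proj[of "a \<odot>\<^bsub>V\<^esub> x"] module_hom_smult[OF g, of a x]
    by (simp add: quot_space_def[of V W] quot_in_carrier)
qed (auto intro: module_hom_in[OF g] quot_in_carrier)

end

end

section \<open>Kernels of structure maps and the contraction\<close>

lemma is_krepD: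
  assumes "is_krep K r M"
  shows "vectorspace K (sp1 M)" "vectorspace.fin_dim K (sp1 M)"
    "vectorspace K (sp2 M)" "vectorspace.fin_dim K (sp2 M)"
    "psi M \<in> lin_maps K (tens r (sp1 M)) (sp2 M)"
    "psi M \<in> module_hom K (tens r (sp1 M)) (sp2 M)"
  using assms by (auto simp: is_krep_def lin_maps_def)

lemma krep_homD:
  assumes "(f1, f2) \<in> krep_hom K r M N"
  shows "f1 \<in> lin_maps K (sp1 M) (sp1 N)" "f2 \<in> lin_maps K (sp2 M) (sp2 N)"
    "f1 \<in> module_hom K (sp1 M) (sp1 N)" "f2 \<in> module_hom K (sp2 M) (sp2 N)"
    "x \<in> carrier (tens r (sp1 M)) \<Longrightarrow> f2 (psi M x) = psi N (tens_map f1 x)"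
  using assms by (auto simp: krep_hom_def lin_maps_def)

lemma carrier_ker_psi:
  "carrier (ker_psi r M) = {x \<in> carrier (tens r (sp1 M)). psi M x = \<zero>\<^bsub>sp2 M\<^esub>}"
  by (simp add: ker_psi_def a_kernel_def')

text \<open>\<open>ker_psi\<close> changes only the carrier of \<open>tens r (sp1 M)\<close>, so it
  is literally the subspace structure \<open>vs\<close> on the kernel, and the results on subspaces
  apply.\<close>

lemma vectorspace_ker_psi:
  assumes "is_krep K r M"
  shows "vectorspace K (ker_psi r M)" "vectorspace.fin_dim K (ker_psi r M)"
proof -
  note M = is_krepD[OF assms]
  interpret T: vectorspace K "tens r (sp1 M)" using M(1) by (rule vectorspace_tens)
  have "subspace K (a_kernel (tens r (sp1 M)) (sp2 M) (psi M)) (tens r (sp1 M))"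
    using linear_map_ker_subspace[OF T.vectorspace_axioms M(3,6)] by (simp add: a_kernel_def')
  then show "vectorspace K (ker_psi r M)" "vectorspace.fin_dim K (ker_psi r M)"
    unfolding ker_psi_def using T.subspace_is_vs T.fin_dim_subspace fin_dim_tens[OF M(1,2)]
    by blast+
qed

lemma contraction_module_hom:
  assumes "vectorspace K V"
  shows "contraction r V \<in> module_hom K (tens r (tens r V)) V"
proof -
  interpret V: vectorspace K V by fact
  note nth1 = tens_nth[where r = r and V = V]
  note nth2 = tens_nth[where r = r and V = "tens r V"]
  show ?thesis
  proof (rule module_homI)
    fix x assume x: "x \<in> carrier (tens r (tens r V))"
    show "contraction r V x \<in> carrier V"
      using x unfolding contraction_def by (intro V.M.finsum_closed) (auto simp: nth1 nth2)
    show "contraction r V (x \<oplus>\<^bsub>tens r (tens r V)\<^esub> y) = contraction r V x \<oplus>\<^bsub>V\<^esub> contraction r V y"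
      if y: "y \<in> carrier (tens r (tens r V))" for y
    proof -
      have "contraction r V (x \<oplus>\<^bsub>tens r (tens r V)\<^esub> y)
          = (\<Oplus>\<^bsub>V\<^esub>i\<in>{..<r}. comps (comps x ! i) ! i \<oplus>\<^bsub>V\<^esub> comps (comps y ! i) ! i)"
        unfolding contraction_def using x y
        by (intro V.M.finsum_cong') (auto simp: nth1 nth2)
      also have "\<dots> = contraction r V x \<oplus>\<^bsub>V\<^esub> contraction r V y"
        unfolding contraction_def using x y
        by (intro V.M.finsum_addf) (auto simp: nth1 nth2)
      finally show ?thesis .
    qed
    show "contraction r V (a \<odot>\<^bsub>tens r (tens r V)\<^esub> x) = a \<odot>\<^bsub>V\<^esub> contraction r V x"
      if a: "a \<in> carrier K" for a
    proof -
      have "contraction r V (a \<odot>\<^bsub>tens r (tens r V)\<^esub> x)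
          = (\<Oplus>\<^bsub>V\<^esub>i\<in>{..<r}. a \<odot>\<^bsub>V\<^esub> comps (comps x ! i) ! i)"
        unfolding contraction_def using x a
        by (intro V.M.finsum_cong') (auto simp: nth1 nth2)
      also have "\<dots> = a \<odot>\<^bsub>V\<^esub> contraction r V x"
        unfolding contraction_def using x a
        by (intro V.finsum_smult_ldistr[symmetric]) (auto simp: nth1 nth2)
      finally show ?thesis .
    qed
  qed
qed

lemma tens_ker_psi_subset: "carrier (tens r (ker_psi r M)) \<subseteq> carrier (tens r (tens r (sp1 M)))"
  by (auto simp: tens_carrier_iff[of _ r "ker_psi r M"] tens_carrier_iff[of _ r "tens r (sp1 M)"]
      carrier_ker_psi)

text \<open>Tensoring the kernel gives a smaller carrier with the operations of
  \<open>tens r (tens r (sp1 M))\<close>, so linearity is inherited.\<close>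

lemma contraction_ker_psi:
  assumes "vectorspace K (sp1 M)"
  shows "contraction r (sp1 M) \<in> module_hom K (tens r (ker_psi r M)) (sp1 M)"
  by (rule module_hom_subset[OF contraction_module_hom[OF assms] tens_ker_psi_subset])
    (simp_all add: tens_def ker_psi_def)

text \<open>Through this formula the structure map of \<open>sigma\<close> reads off coordinates,
  which lets a morphism into \<open>sigma Q\<close> be recovered from its second component. The
  padding zero of \<open>ker_psi\<close> is the zero tensor, so the other diagonal entries
  vanish.\<close>

lemma contraction_arr_ker_psi:
  assumes "vectorspace K (sp1 M)" "x \<in> carrier (tens r (sp1 M))" "i < r"
  shows "contraction r (sp1 M) (arr r (ker_psi r M) i x) = comps x ! i"
proof -
  interpret V: vectorspace K "sp1 M" by fact
  have "contraction r (sp1 M) (arr r (ker_psi r M) i x)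
      = (\<Oplus>\<^bsub>sp1 M\<^esub>j\<in>{..<r}. if i = j then comps x ! j else \<zero>\<^bsub>sp1 M\<^esub>)"
    unfolding contraction_def using assms(2,3)
    by (intro V.M.finsum_cong') (auto simp: arr_nth tens_carrierD(2) ker_psi_def tens_zero_nth)
  also have "\<dots> = comps x ! i"
    using assms(2,3) by (intro V.M.add.finprod_singleton) (auto intro: tens_carrierD(2))
  finally show ?thesis .
qed

text \<open>Naturality of the contraction: this is the compatibility condition for
  \<open>sigma\<close> on morphisms.\<close>

lemma tens_map_contraction:
  assumes "vectorspace K V" "vectorspace K W" "f \<in> module_hom K V W" "x \<in> carrier (tens r (tens r V))"
  shows "f (contraction r V x) = contraction r W (tens_map (tens_map f) x)"
proof -
  interpret W: vectorspace K W by fact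
  note nth1 = tens_nth[where r = r and V = V]
  note nth2 = tens_nth[where r = r and V = "tens r V"]
  have "f (contraction r V x) = (\<Oplus>\<^bsub>W\<^esub>i\<in>{..<r}. f (comps (comps x ! i) ! i))"
    unfolding contraction_def using assms(4)
    by (intro module_hom_finsum[OF assms(1-3)]) (auto simp: nth1 nth2)
  also have "\<dots> = contraction r W (tens_map (tens_map f) x)"
    unfolding contraction_def using assms(4) module_hom_in[OF assms(3)]
    by (intro W.M.finsum_cong') (auto simp: nth1 nth2)
  finally show ?thesis .
qed

section \<open>The map \<open>eta\<close> and its naturality\<close>

lemma eta_nth: "i < r \<Longrightarrow> comps (eta r M m) ! i = psi M (arr r (sp1 M) i m)"
  by (simp add: eta_def)

lemma eta_closed:
  assumes "is_krep K r M" "m \<in> carrier (sp1 M)"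
  shows "eta r M m \<in> carrier (tens r (sp2 M))"
proof -
  note M = is_krepD[OF assms(1)]
  interpret V: vectorspace K "sp1 M" by (rule M)
  show ?thesis unfolding eta_def
    by (rule Tup_map_in_tens, rule module_hom_in[OF M(6)], rule arr_closed) (use assms(2) in auto)
qed

lemma eta_module_hom:
  assumes "is_krep K r M"
  shows "eta r M \<in> module_hom K (sp1 M) (tens r (sp2 M))"
proof -
  note M = is_krepD[OF assms]
  interpret V: vectorspace K "sp1 M" by (rule M)
  interpret T: vectorspace K "tens r (sp2 M)" using M(3) by (rule vectorspace_tens)
  note cl = eta_closed[OF assms]
  \<comment> \<open>Each coordinate of \<open>eta r M\<close> is the composite of \<open>arr\<close>
    with \<open>psi M\<close>, hence linear.\<close>
  note h = module_hom_comp[OF arr_module_hom[OF M(1)] M(6)]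
  show ?thesis
  proof (rule module_homI)
    show "eta r M (x \<oplus>\<^bsub>sp1 M\<^esub> y) = eta r M x \<oplus>\<^bsub>tens r (sp2 M)\<^esub> eta r M y"
      if "x \<in> carrier (sp1 M)" "y \<in> carrier (sp1 M)" for x y
      using that cl module_hom_add[OF h]
      by (rule_tac tens_eqI[of _ r "sp2 M" _ "sp2 M"])
        (simp_all add: eta_nth tens_add_nth[where V = "sp2 M"])
    show "eta r M (a \<odot>\<^bsub>sp1 M\<^esub> x) = a \<odot>\<^bsub>tens r (sp2 M)\<^esub> eta r M x"
      if "a \<in> carrier K" "x \<in> carrier (sp1 M)" for a x
      using that cl module_hom_smult[OF h]
      by (rule_tac tens_eqI[of _ r "sp2 M" _ "sp2 M"])
        (simp_all add: eta_nth tens_smult_nth[where V = "sp2 M"])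
  qed (rule cl)
qed

text \<open>Naturality of \<open>eta\<close>: in each coordinate it is the compatibility condition
  of the morphism at a simple tensor. It yields both the induced map on cokernels and the naturality
  of the adjunction.\<close>

lemma tens_map_eta:
  assumes "is_krep K r M" "is_krep K r N" "(f1, f2) \<in> krep_hom K r M N" "m \<in> carrier (sp1 M)"
  shows "tens_map f2 (eta r M m) = eta r N (f1 m)"
proof -
  note M = is_krepD[OF assms(1)] and N = is_krepD[OF assms(2)] and f = krep_homD[OF assms(3)]
  interpret V: vectorspace K "sp1 M" by (rule M)
  have z: "f1 \<zero>\<^bsub>sp1 M\<^esub> = \<zero>\<^bsub>sp1 N\<^esub>" by (rule module_hom_zero[OF M(1) N(1) f(3)])
  \<comment> \<open>No bound on \<open>i\<close> is needed: for \<open>i\<close> beyond the range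
    the list update does nothing and \<open>arr\<close> is the zero tensor.\<close>
  have "f2 (psi M (arr r (sp1 M) i m)) = psi N (arr r (sp1 N) i (f1 m))" for i
    using f(5)[of "arr r (sp1 M) i m"] tens_map_arr[of f1 "sp1 M" "sp1 N" r i m, OF z] assms(4)
    by (simp add: arr_closed)
  then show ?thesis by (simp add: eta_def tens_map_def)
qed

lemma subspace_quotient_eta:
  assumes "is_krep K r M"
  shows "subspace_quotient K (tens r (sp2 M)) (eta r M ` carrier (sp1 M))"
proof -
  note M = is_krepD[OF assms]
  have "subspace K (eta r M ` carrier (sp1 M)) (tens r (sp2 M))"
    by (rule linear_map_image_subspace[OF M(1) vectorspace_tens[OF M(3)] eta_module_hom[OF assms]])
  then show ?thesis by (simp add: subspace_quotient_def subspace_def)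
qed


section \<open>The category \<open>rep(K\<^sub>r)\<close> and its functors\<close>

lemma is_category_rep_cat: "is_category (rep_cat K r :: (('k, 'a) krep, 'a kmor) category_data)"
proof -
  let ?C = "rep_cat K r :: (('k, 'a) krep, 'a kmor) category_data"
  have Id: "Id ?C X \<in> Hom ?C X X" if "X \<in> Ob ?C" for X
  proof -
    from that have "is_krep K r X" by (simp add: rep_cat_def)
    note X = is_krepD[OF this]
    have id_hom: "id \<in> module_hom K V V" for V :: "('k, 'a) space" by (auto simp: module_hom_def)
    have "tens_map (restrict id (carrier (sp1 X))) x = x" if "x \<in> carrier (tens r (sp1 X))" for x
      using that by (rule tens_map_id)
    then show ?thesis
      using restrict_lin_maps[OF X(1) id_hom] restrict_lin_maps[OF X(3) id_hom] module_hom_in[OF X(6)]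
      by (auto simp: rep_cat_def krep_hom_def)
  qed
  have Comp: "Comp ?C X Y Z g f \<in> Hom ?C X Z"
    if "X \<in> Ob ?C" "Y \<in> Ob ?C" "Z \<in> Ob ?C" "f \<in> Hom ?C X Y" "g \<in> Hom ?C Y Z" for X Y Z f g
  proof -
    obtain f1 f2 g1 g2 where [simp]: "f = (f1, f2)" "g = (g1, g2)" by (cases f, cases g)
    from that have *: "is_krep K r X" "(f1, f2) \<in> krep_hom K r X Y" "(g1, g2) \<in> krep_hom K r Y Z"
      by (simp_all add: rep_cat_def)
    note X = is_krepD[OF *(1)] and f = krep_homD[OF *(2)] and g = krep_homD[OF *(3)]
    have "compose (carrier (sp2 X)) g2 f2 (psi X x)
        = psi Z (tens_map (compose (carrier (sp1 X)) g1 f1) x)"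
      if x: "x \<in> carrier (tens r (sp1 X))" for x
    proof -
      have "tens_map (compose (carrier (sp1 X)) g1 f1) x = tens_map g1 (tens_map f1 x)"
        using x by (rule tens_map_compose)
      moreover have "tens_map f1 x \<in> carrier (tens r (sp1 Y))"
        using x tens_map_in[OF f(3)] by blast
      ultimately show ?thesis
        using x f(5) g(5) module_hom_in[OF X(6)] by (simp add: compose_eq)
    qed
    then show ?thesis
      using compose_lin_maps[OF X(1) f(1) g(1)] compose_lin_maps[OF X(3) f(2) g(2)]
      by (auto simp: rep_cat_def krep_hom_def)
  qed
  \<comment> \<open>The unit laws are equalities of functions because morphisms are
    \<open>undefined\<close> off their domains.\<close>
  have ext: "compose (carrier V) (restrict id (carrier W)) f = f"
      "compose (carrier V) f (restrict id (carrier V)) = f"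
    if "f \<in> lin_maps K V W" for V W :: "('k, 'a) space" and f
    using lin_mapsD[OF that] module_hom_in[of f K V W]
    by (auto simp: compose_def extensional_def)
  \<comment> \<open>The two nestings of \<open>compose\<close> restrict to different carriers; they
    agree because \<open>f\<close> maps \<open>U\<close> into \<open>V\<close>.\<close>
  have assoc: "compose (carrier U) (compose (carrier V) h g) f
      = compose (carrier U) h (compose (carrier U) g f)"
    if "f \<in> lin_maps K U V" for U V :: "('k, 'a) space" and f g h
    using module_hom_in[OF lin_mapsD(1)[OF that]] by (auto simp: compose_def)
  show ?thesis
    unfolding is_category_def
    using Id Comp by (auto simp: rep_cat_def krep_hom_def ext assoc)
qed

text \<open>Presents the functor laws for morphisms already split into pairs, with composition in
  the source category unfolded.\<close>

lemma is_functor_rep_catI: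
  fixes F :: "('k, 'a) kfunctor"
  assumes "\<And>X. is_krep K r X \<Longrightarrow> is_krep K s (omap F X)"
    and "\<And>X Y f1 f2. is_krep K r X \<Longrightarrow> is_krep K r Y \<Longrightarrow> (f1, f2) \<in> krep_hom K r X Y \<Longrightarrow>
          fmap F X Y (f1, f2) \<in> krep_hom K s (omap F X) (omap F Y)"
    and "\<And>X. is_krep K r X \<Longrightarrow> fmap F X X (Id (rep_cat K r) X) = Id (rep_cat K s) (omap F X)"
    and "\<And>X Y Z f1 f2 g1 g2. is_krep K r X \<Longrightarrow> is_krep K r Y \<Longrightarrow> is_krep K r Z \<Longrightarrow>
          (f1, f2) \<in> krep_hom K r X Y \<Longrightarrow> (g1, g2) \<in> krep_hom K r Y Z \<Longrightarrow>
          fmap F X Z (compose (carrier (sp1 X)) g1 f1, compose (carrier (sp2 X)) g2 f2)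
            = Comp (rep_cat K s) (omap F X) (omap F Y) (omap F Z) (fmap F Y Z (g1, g2)) (fmap F X Y (f1, f2))"
  shows "is_functor (rep_cat K r) (rep_cat K s) F"
  unfolding is_functor_def
  using assms is_category_rep_cat[of K r] is_category_rep_cat[of K s]
  by (auto simp: rep_cat_def)

lemma is_functor_fun_comp:
  assumes "is_functor C D F" "is_functor D E G"
  shows "is_functor C E (G \<circ>F F)"
  using assms unfolding is_functor_def fun_comp_def by simp

section \<open>Restriction and inflation are functors\<close>

lemma is_functor_res:
  assumes "s \<le> r"
  shows "is_functor (rep_cat K r) (rep_cat K s) (res_functor s r :: ('k, 'a) kfunctor)"
proof (rule is_functor_rep_catI)
  fix X :: "('k, 'a) krep" assume X: "is_krep K r X"
  note XD = is_krepD[OF X]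
  note hom = module_hom_comp[OF tens_embed_module_hom[OF XD(1) assms] XD(6)]
  show "is_krep K s (omap (res_functor s r) X)"
    using restrict_lin_maps[OF vectorspace_tens[OF XD(1)] hom] XD
    by (simp add: is_krep_def res_functor_def)
  fix Y f1 f2 assume Y: "is_krep K r Y" and f: "(f1, f2) \<in> krep_hom K r X Y"
  note YD = is_krepD[OF Y] and fD = krep_homD[OF f]
  \<comment> \<open>Embedding pads with zeros, so it commutes with \<open>tens_map f1\<close>
    because \<open>f1\<close> preserves zero.\<close>
  have "f2 (psi X (tens_embed s r (sp1 X) x)) = psi Y (tens_embed s r (sp1 Y) (tens_map f1 x))"
    if "x \<in> carrier (tens s (sp1 X))" for x
    using module_hom_in[OF tens_embed_module_hom[OF XD(1) assms] that]
    by (simp add: fD(5) tens_map_embed module_hom_zero[OF XD(1) YD(1) fD(3)])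
  then show "fmap (res_functor s r) X Y (f1, f2)
      \<in> krep_hom K s (omap (res_functor s r) X) (omap (res_functor s r) Y)"
    using fD(1,2) tens_map_in[OF fD(3)]
    by (auto simp: krep_hom_def res_functor_def)
qed (auto simp: res_functor_def rep_cat_def)

lemma is_functor_inf:
  assumes "s \<le> r"
  shows "is_functor (rep_cat K s) (rep_cat K r) (inf_functor s r :: ('k, 'a) kfunctor)"
proof (rule is_functor_rep_catI)
  fix X :: "('k, 'a) krep" assume X: "is_krep K s X"
  note XD = is_krepD[OF X]
  note hom = module_hom_comp[OF tens_trunc_module_hom[OF assms] XD(6)]
  show "is_krep K r (omap (inf_functor s r) X)"
    using restrict_lin_maps[OF vectorspace_tens[OF XD(1)] hom] XD
    by (simp add: is_krep_def inf_functor_def)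
  fix Y f1 f2 assume f: "(f1, f2) \<in> krep_hom K s X Y"
  note fD = krep_homD[OF f]
  \<comment> \<open>Truncation involves no padding and commutes with \<open>tens_map\<close> of any
    function.\<close>
  have "f2 (psi X (tens_trunc s x)) = psi Y (tens_trunc s (tens_map f1 x))"
    if "x \<in> carrier (tens r (sp1 X))" for x
    using module_hom_in[OF tens_trunc_module_hom[OF assms] that]
    by (simp add: fD(5) tens_map_trunc)
  then show "fmap (inf_functor s r) X Y (f1, f2)
      \<in> krep_hom K r (omap (inf_functor s r) X) (omap (inf_functor s r) Y)"
    using fD(1,2) tens_map_in[OF fD(3)]
    by (auto simp: krep_hom_def inf_functor_def)
qed (auto simp: inf_functor_def rep_cat_def)

section \<open>The functor \<open>sigma\<close>\<close>

lemma tens_map_ker_psi: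
  assumes "is_krep K r X" "is_krep K r Y" "(f1, f2) \<in> krep_hom K r X Y" "x \<in> carrier (ker_psi r X)"
  shows "tens_map f1 x \<in> carrier (ker_psi r Y)"
proof -
  note X = is_krepD[OF assms(1)] and Y = is_krepD[OF assms(2)] and f = krep_homD[OF assms(3)]
  have x: "x \<in> carrier (tens r (sp1 X))" "psi X x = \<zero>\<^bsub>sp2 X\<^esub>"
    using assms(4) by (auto simp: carrier_ker_psi)
  have "psi Y (tens_map f1 x) = \<zero>\<^bsub>sp2 Y\<^esub>"
    using f(5)[OF x(1)] x(2) module_hom_zero[OF X(3) Y(3) f(4)] by simp
  then show ?thesis using tens_map_in[OF f(3) x(1)] by (simp add: carrier_ker_psi)
qed

lemma is_functor_sigma:
  "is_functor (rep_cat K r) (rep_cat K r) (sigma r :: ('k, 'a) kfunctor)"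
proof (rule is_functor_rep_catI)
  fix X :: "('k, 'a) krep" assume X: "is_krep K r X"
  note XD = is_krepD[OF X] and kX = vectorspace_ker_psi[OF X]
  show "is_krep K r (omap (sigma r) X)"
    using restrict_lin_maps[OF vectorspace_tens[OF kX(1)] contraction_ker_psi[OF XD(1)]] XD kX
    by (simp add: is_krep_def sigma_def)
  show "fmap (sigma r) X X (Id (rep_cat K r) X) = Id (rep_cat K r) (omap (sigma r) X)"
  proof -
    have "tens_map (restrict id (carrier (sp1 X))) x = x" if "x \<in> carrier (ker_psi r X)" for x
      using that by (intro tens_map_id[of _ r]) (simp add: carrier_ker_psi)
    then show ?thesis by (auto simp: sigma_def rep_cat_def)
  qed
  fix Y f1 f2 assume Y: "is_krep K r Y" and f: "(f1, f2) \<in> krep_hom K r X Y"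
  note YD = is_krepD[OF Y] and fD = krep_homD[OF f]
  note ker = tens_map_ker_psi[OF X Y f]
  show "fmap (sigma r) X Y (f1, f2) \<in> krep_hom K r (omap (sigma r) X) (omap (sigma r) Y)"
  proof -
    have "tens_map f1 \<in> module_hom K (ker_psi r X) (ker_psi r Y)"
    proof (rule module_homI)
      have sub: "carrier (ker_psi r X) \<subseteq> carrier (tens r (sp1 X))" by (auto simp: carrier_ker_psi)
      \<comment> \<open>Linearity is first obtained into the full tensor space; it passes to the
        kernel since the operations coincide.\<close>
      have h: "tens_map f1 \<in> module_hom K (ker_psi r X) (tens r (sp1 Y))"
        by (rule module_hom_subset[OF tens_map_module_hom[OF XD(1) fD(3)] sub])
          (simp_all add: ker_psi_def)
      show "tens_map f1 (x \<oplus>\<^bsub>ker_psi r X\<^esub> y) = tens_map f1 x \<oplus>\<^bsub>ker_psi r Y\<^esub> tens_map f1 y"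
        if "x \<in> carrier (ker_psi r X)" "y \<in> carrier (ker_psi r X)" for x y
        using module_hom_add[OF h that] by (simp add: ker_psi_def)
      show "tens_map f1 (a \<odot>\<^bsub>ker_psi r X\<^esub> x) = a \<odot>\<^bsub>ker_psi r Y\<^esub> tens_map f1 x"
        if "a \<in> carrier K" "x \<in> carrier (ker_psi r X)" for a x
        using module_hom_smult[OF h that] by (simp add: ker_psi_def)
    qed (rule ker)
    then have lin: "restrict (tens_map f1) (carrier (ker_psi r X)) \<in> lin_maps K (ker_psi r X) (ker_psi r Y)"
      by (rule restrict_lin_maps[OF vectorspace_ker_psi(1)[OF X]])
    have "f1 (contraction r (sp1 X) x)
        = contraction r (sp1 Y) (tens_map (restrict (tens_map f1) (carrier (ker_psi r X))) x)"
      and "tens_map (restrict (tens_map f1) (carrier (ker_psi r X))) x \<in> carrier (tens r (ker_psi r Y))"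
      if x: "x \<in> carrier (tens r (ker_psi r X))" for x
    proof -
      \<comment> \<open>The restriction on the first component is invisible here, since all
        coordinates of \<open>x\<close> lie in the kernel.\<close>
      have eq: "tens_map (restrict (tens_map f1) (carrier (ker_psi r X))) x = tens_map (tens_map f1) x"
        using x by (auto simp: tens_map_def tens_carrier_iff[of _ r "ker_psi r X"] in_set_conv_nth)
      show "f1 (contraction r (sp1 X) x)
        = contraction r (sp1 Y) (tens_map (restrict (tens_map f1) (carrier (ker_psi r X))) x)"
        unfolding eq using x tens_ker_psi_subset
        by (intro tens_map_contraction[OF XD(1) YD(1) fD(3)]) blast
      show "tens_map (restrict (tens_map f1) (carrier (ker_psi r X))) x \<in> carrier (tens r (ker_psi r Y))"
        unfolding eq by (rule tens_map_closed[OF _ x]) (rule ker)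
    qed
    then show ?thesis using lin fD(1) by (auto simp: krep_hom_def sigma_def)
  qed
  fix Z g1 g2 assume Z: "is_krep K r Z" and g: "(g1, g2) \<in> krep_hom K r Y Z"
  have "tens_map (compose (carrier (sp1 X)) g1 f1) x = tens_map g1 (tens_map f1 x)"
    if "x \<in> carrier (ker_psi r X)" for x
    using that by (intro tens_map_compose[of _ r]) (simp add: carrier_ker_psi)
  then show "fmap (sigma r) X Z (compose (carrier (sp1 X)) g1 f1, compose (carrier (sp2 X)) g2 f2)
      = Comp (rep_cat K r) (omap (sigma r) X) (omap (sigma r) Y) (omap (sigma r) Z)
          (fmap (sigma r) Y Z (g1, g2)) (fmap (sigma r) X Y (f1, f2))"
    using ker by (auto simp: sigma_def rep_cat_def compose_def)
qed

section \<open>The functor \<open>sigma_inv\<close>\<close>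

lemma sp_sigma_inv [simp]:
  "sp1 (omap (sigma_inv r) M) = sp2 M" "sp2 (omap (sigma_inv r) M) = coker_eta r M"
  "psi (omap (sigma_inv r) M) = restrict (eta_proj r M) (carrier (tens r (sp2 M)))"
  by (simp_all add: sigma_inv_def)

lemma fmap_sigma_inv:
  "fmap (sigma_inv r) M N (f1, f2)
     = (f2, restrict (\<lambda>x. eta_proj r N (tens_map f2 x)) (carrier (coker_eta r M)))"
  by (simp add: sigma_inv_def)

text \<open>By \<open>tens_map_eta\<close>, \<open>tens_map f2\<close> sends the image of
  \<open>eta r X\<close> into that of \<open>eta r Y\<close>, so its composite with the projection
  kills the former. Then \<open>hom_quot\<close> gives linearity on the cokernel and
  \<open>hom_proj\<close> independence of the representative.\<close>

lemma coker_map_hom: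
  assumes "is_krep K r X" "is_krep K r Y" "(f1, f2) \<in> krep_hom K r X Y"
  shows "(\<lambda>x. eta_proj r Y (tens_map f2 x)) \<in> module_hom K (coker_eta r X) (coker_eta r Y)"
    and "x \<in> carrier (tens r (sp2 X)) \<Longrightarrow>
      eta_proj r Y (tens_map f2 (eta_proj r X x)) = eta_proj r Y (tens_map f2 x)"
proof -
  note X = is_krepD[OF assms(1)] and Y = is_krepD[OF assms(2)] and f = krep_homD[OF assms(3)]
  interpret QX: subspace_quotient K "tens r (sp2 X)" "eta r X ` carrier (sp1 X)"
    by (rule subspace_quotient_eta[OF assms(1)])
  interpret QY: subspace_quotient K "tens r (sp2 Y)" "eta r Y ` carrier (sp1 Y)"
    by (rule subspace_quotient_eta[OF assms(2)])
  note h = module_hom_comp[OF tens_map_module_hom[OF X(3) f(4)] QY.proj_hom]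
  have z: "QY.p (tens_map f2 w) = \<zero>\<^bsub>QY.Q\<^esub>" if w: "w \<in> eta r X ` carrier (sp1 X)" for w
  proof -
    from w obtain m where m: "m \<in> carrier (sp1 X)" "w = eta r X m" by blast
    show ?thesis
      unfolding m(2) tens_map_eta[OF assms m(1)]
      by (intro QY.proj_W imageI module_hom_in[OF f(3) m(1)])
  qed
  show "(\<lambda>x. eta_proj r Y (tens_map f2 x)) \<in> module_hom K (coker_eta r X) (coker_eta r Y)"
    unfolding eta_proj_def coker_eta_def
    by (rule QX.hom_quot[OF QY.vectorspace_quot h z])
  show "eta_proj r Y (tens_map f2 (eta_proj r X x)) = eta_proj r Y (tens_map f2 x)"
    if "x \<in> carrier (tens r (sp2 X))"
    unfolding eta_proj_def using QX.hom_proj[OF QY.vectorspace_quot h z that] .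
qed

lemma coker_eta_properties:
  assumes "is_krep K r M"
  shows "vectorspace K (coker_eta r M)" "vectorspace.fin_dim K (coker_eta r M)"
    "eta_proj r M \<in> module_hom K (tens r (sp2 M)) (coker_eta r M)"
    "carrier (coker_eta r M) = eta_proj r M ` carrier (tens r (sp2 M))"
    "x \<in> carrier (coker_eta r M) \<Longrightarrow> x \<in> carrier (tens r (sp2 M))"
    "x \<in> carrier (coker_eta r M) \<Longrightarrow> eta_proj r M x = x"
proof -
  note M = is_krepD[OF assms]
  interpret subspace_quotient K "tens r (sp2 M)" "eta r M ` carrier (sp1 M)"
    by (rule subspace_quotient_eta[OF assms])
  show "vectorspace K (coker_eta r M)" "vectorspace.fin_dim K (coker_eta r M)"
    "eta_proj r M \<in> module_hom K (tens r (sp2 M)) (coker_eta r M)"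
    "carrier (coker_eta r M) = eta_proj r M ` carrier (tens r (sp2 M))"
    "x \<in> carrier (coker_eta r M) \<Longrightarrow> x \<in> carrier (tens r (sp2 M))"
    "x \<in> carrier (coker_eta r M) \<Longrightarrow> eta_proj r M x = x"
    unfolding coker_eta_def eta_proj_def
    by (rule vectorspace_quot fin_dim_quot[OF fin_dim_tens[OF M(3,4)]] proj_hom carrier_quot
        quot_in_carrier proj_quot; assumption?)+
qed

lemma is_functor_sigma_inv:
  "is_functor (rep_cat K r) (rep_cat K r) (sigma_inv r :: ('k, 'a) kfunctor)"
proof (rule is_functor_rep_catI)
  fix X :: "('k, 'a) krep" assume X: "is_krep K r X"
  note XD = is_krepD[OF X] and cX = coker_eta_properties[OF X]
  show "is_krep K r (omap (sigma_inv r) X)"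
    using restrict_lin_maps[OF vectorspace_tens[OF XD(3)] cX(3)] XD(3,4) cX(1,2)
    by (simp add: is_krep_def)
  show "fmap (sigma_inv r) X X (Id (rep_cat K r) X) = Id (rep_cat K r) (omap (sigma_inv r) X)"
  proof -
    have "eta_proj r X (tens_map (restrict id (carrier (sp2 X))) x) = x"
      if "x \<in> carrier (coker_eta r X)" for x
      using tens_map_id[OF cX(5)[OF that]] cX(6)[OF that] by simp
    then show ?thesis by (auto simp: fmap_sigma_inv rep_cat_def)
  qed
  fix Y f1 f2 assume Y: "is_krep K r Y" and f: "(f1, f2) \<in> krep_hom K r X Y"
  note fD = krep_homD[OF f] and cf = coker_map_hom[OF X Y f]
  show "fmap (sigma_inv r) X Y (f1, f2) \<in> krep_hom K r (omap (sigma_inv r) X) (omap (sigma_inv r) Y)"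
    using fD(2) restrict_lin_maps[OF cX(1) cf(1)] cf(2) tens_map_in[OF fD(4)]
      module_hom_in[OF cX(3)]
    by (auto simp: krep_hom_def fmap_sigma_inv)
  fix Z g1 g2 assume Z: "is_krep K r Z" and g: "(g1, g2) \<in> krep_hom K r Y Z"
  note cg = coker_map_hom[OF Y Z g]
  \<comment> \<open>The composite of induced maps passes through a chosen representative in the
    cokernel of \<open>Y\<close>; \<open>cg(2)\<close> removes this choice.\<close>
  have "eta_proj r Z (tens_map (compose (carrier (sp2 X)) g2 f2) x)
      = eta_proj r Z (tens_map g2 (eta_proj r Y (tens_map f2 x)))"
    if "x \<in> carrier (coker_eta r X)" for x
    using cX(5)[OF that] by (simp add: tens_map_compose cg(2) tens_map_in[OF fD(4)])
  then show "fmap (sigma_inv r) X Z (compose (carrier (sp1 X)) g1 f1, compose (carrier (sp2 X)) g2 f2)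
      = Comp (rep_cat K r) (omap (sigma_inv r) X) (omap (sigma_inv r) Y) (omap (sigma_inv r) Z)
          (fmap (sigma_inv r) Y Z (g1, g2)) (fmap (sigma_inv r) X Y (f1, f2))"
    using module_hom_in[OF cf(1)] by (auto simp: fmap_sigma_inv rep_cat_def compose_def)
qed


section \<open>The adjunctions\<close>

text \<open>Compatibility at the simple tensor of \<open>x\<close> in position \<open>i\<close>
  determines the \<open>i\<close>-th coordinate of \<open>f1 x\<close> from \<open>f2\<close>. The
  vanishing condition says that the map so determined lands in the kernel of
  \<open>psi Q\<close>.\<close>

lemma sigma_hom_iff:
  assumes X: "is_krep K b X" and Q: "is_krep K b Q"
  shows "(f1, f2) \<in> krep_hom K b X (omap (sigma b) Q) \<longleftrightarrow>
    f2 \<in> lin_maps K (sp2 X) (sp1 Q) \<and> f1 = (\<lambda>x\<in>carrier (sp1 X). tens_map f2 (eta b X x)) \<and>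
    (\<forall>x\<in>carrier (sp1 X). psi Q (tens_map f2 (eta b X x)) = \<zero>\<^bsub>sp2 Q\<^esub>)" (is "?L \<longleftrightarrow> ?R")
proof -
  note XD = is_krepD[OF X] and QD = is_krepD[OF Q]
  interpret V: vectorspace K "sp1 X" by (rule XD)
  interpret QV: vectorspace K "sp1 Q" by (rule QD)
  interpret Ker: vectorspace K "ker_psi b Q" by (rule vectorspace_ker_psi[OF Q])
  have sig: "sp1 (omap (sigma b) Q) = ker_psi b Q" "sp2 (omap (sigma b) Q) = sp1 Q"
    "psi (omap (sigma b) Q) = restrict (contraction b (sp1 Q)) (carrier (tens b (ker_psi b Q)))"
    by (simp_all add: sigma_def)
  show ?thesis
  proof
    assume L: ?L
    note f = krep_homD[OF L, unfolded sig]
    have f1: "f1 x = tens_map f2 (eta b X x)" if x: "x \<in> carrier (sp1 X)" for x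
    proof (rule tens_eqI[of _ b "sp1 Q" _ "sp1 Q"])
      have ker: "f1 x \<in> carrier (ker_psi b Q)" by (rule module_hom_in[OF f(3) x])
      then show t: "f1 x \<in> carrier (tens b (sp1 Q))" by (simp add: carrier_ker_psi)
      show "tens_map f2 (eta b X x) \<in> carrier (tens b (sp1 Q))"
        by (rule tens_map_in[OF f(4) eta_closed[OF X x]])
      fix i assume i: "i < b"
      have arr: "arr b (sp1 X) i x \<in> carrier (tens b (sp1 X))" using x by (simp add: arr_closed)
      have "tens_map f1 (arr b (sp1 X) i x) = arr b (ker_psi b Q) i (f1 x)"
        by (rule tens_map_arr)
          (rule module_hom_zero[OF XD(1) Ker.vectorspace_axioms f(3)])
      then have "f2 (psi X (arr b (sp1 X) i x)) = comps (f1 x) ! i"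
        using f(5)[OF arr] ker contraction_arr_ker_psi[OF QD(1) t i]
        by (simp add: arr_closed)
      then show "comps (f1 x) ! i = comps (tens_map f2 (eta b X x)) ! i"
        using i by (simp add: eta_def tens_map_def)
    qed
    moreover have "psi Q (f1 x) = \<zero>\<^bsub>sp2 Q\<^esub>" if "x \<in> carrier (sp1 X)" for x
      using module_hom_in[OF f(3) that] by (simp add: carrier_ker_psi)
    ultimately show ?R
      using f(2) lin_mapsD(2)[OF f(1)] by (auto simp: extensional_def)
  next
    assume R: ?R
    then have f2: "f2 \<in> lin_maps K (sp2 X) (sp1 Q)" by blast
    note f2D = lin_mapsD(1)[OF f2]
    note h = module_hom_comp[OF eta_module_hom[OF X] tens_map_module_hom[OF XD(3) f2D]]
    have ker: "tens_map f2 (eta b X x) \<in> carrier (ker_psi b Q)" if "x \<in> carrier (sp1 X)" for x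
      using R that module_hom_in[OF h that] by (simp add: carrier_ker_psi)
    have hk: "(\<lambda>x. tens_map f2 (eta b X x)) \<in> module_hom K (sp1 X) (ker_psi b Q)"
      using module_hom_add[OF h] module_hom_smult[OF h]
      by (intro module_homI ker) (simp_all add: ker_psi_def)
    have f1: "f1 \<in> lin_maps K (sp1 X) (ker_psi b Q)"
      using R restrict_lin_maps[OF XD(1) hk] by simp
    \<comment> \<open>Expanding \<open>x\<close> into simple tensors turns the left side into a sum
      over the arrows; the contraction is a sum over the same indices, and the summands agree one by
      one.\<close>
    have "f2 (psi X x) = contraction b (sp1 Q) (tens_map f1 x)"
      if x: "x \<in> carrier (tens b (sp1 X))" for x
    proof -
      note nth = tens_nth[where r = b and V = "sp1 X"]
      have "f2 (psi X x) = f2 (psi X (\<Oplus>\<^bsub>tens b (sp1 X)\<^esub>i\<in>{..<b}. arr b (sp1 X) i (comps x ! i)))"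
        using tens_expand[OF XD(1) x] by simp
      also have "\<dots> = (\<Oplus>\<^bsub>sp1 Q\<^esub>i\<in>{..<b}. f2 (psi X (arr b (sp1 X) i (comps x ! i))))"
        using x by (intro module_hom_finsum[OF vectorspace_tens[OF XD(1)] QD(1)
            module_hom_comp[OF XD(6) f2D]] arr_closed) (auto simp: nth)
      also have "\<dots> = contraction b (sp1 Q) (tens_map f1 x)"
        unfolding contraction_def
      proof (intro QV.M.finsum_cong' refl funcsetI)
        fix i assume "i \<in> {..<b}"
        then have i: "i < b" and xi: "comps x ! i \<in> carrier (sp1 X)" using x by (auto simp: nth)
        \<comment> \<open>The \<open>i\<close>-th diagonal entry picks the \<open>i\<close>-th
          coordinate of \<open>eta\<close> at the \<open>i\<close>-th coordinate of
          \<open>x\<close>, that is, the action of the same arrow.\<close>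
        have "comps (comps (tens_map f1 x) ! i) ! i = comps (tens_map f2 (eta b X (comps x ! i))) ! i"
          using R xi i x by (simp add: tens_map_nth[where V = "sp1 X"])
        also have "\<dots> = f2 (comps (eta b X (comps x ! i)) ! i)"
          by (rule tens_map_nth[OF eta_closed[OF X xi] i])
        finally show eq: "f2 (psi X (arr b (sp1 X) i (comps x ! i))) = comps (comps (tens_map f1 x) ! i) ! i"
          using i by (simp add: eta_nth)
        show "comps (comps (tens_map f1 x) ! i) ! i \<in> carrier (sp1 Q)"
          unfolding eq[symmetric]
          by (rule module_hom_in[OF f2D module_hom_in[OF XD(6) arr_closed[OF _ xi]]]) simp
      qed
      finally show ?thesis .
    qed
    then show ?L
      using f1 f2 tens_map_in[OF lin_mapsD(1)[OF f1]] by (auto simp: krep_hom_def sig)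
  qed
qed
text \<open>The structure map of \<open>sigma_inv a P\<close> is onto the cokernel, so
  \<open>g1\<close> determines \<open>g2\<close>; such a \<open>g2\<close> exists exactly when
  \<open>psi Y\<close> after \<open>tens_map g1\<close> kills the image of
  \<open>eta a P\<close>.\<close>

lemma sigma_inv_hom_iff:
  assumes P: "is_krep K a P" and Y: "is_krep K a Y"
  shows "(g1, g2) \<in> krep_hom K a (omap (sigma_inv a) P) Y \<longleftrightarrow>
    g1 \<in> lin_maps K (sp2 P) (sp1 Y) \<and>
    g2 = (\<lambda>x\<in>carrier (coker_eta a P). psi Y (tens_map g1 x)) \<and>
    (\<forall>x\<in>carrier (sp1 P). psi Y (tens_map g1 (eta a P x)) = \<zero>\<^bsub>sp2 Y\<^esub>)" (is "?L \<longleftrightarrow> ?R")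
proof -
  note PD = is_krepD[OF P] and YD = is_krepD[OF Y] and c = coker_eta_properties[OF P]
  interpret subspace_quotient K "tens a (sp2 P)" "eta a P ` carrier (sp1 P)"
    by (rule subspace_quotient_eta[OF P])
  show ?thesis
  proof
    assume L: ?L
    note g = krep_homD[OF L, unfolded sp_sigma_inv]
    have *: "g2 (eta_proj a P x) = psi Y (tens_map g1 x)" if "x \<in> carrier (tens a (sp2 P))" for x
      using g(5)[OF that] that by simp
    have "psi Y (tens_map g1 (eta a P x)) = \<zero>\<^bsub>sp2 Y\<^esub>" if x: "x \<in> carrier (sp1 P)" for x
    proof -
      have "eta_proj a P (eta a P x) = \<zero>\<^bsub>coker_eta a P\<^esub>"
        unfolding eta_proj_def coker_eta_def using x by (intro proj_W imageI)
      then show ?thesis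
        using *[OF eta_closed[OF P x]] module_hom_zero[OF c(1) YD(3) g(4)] by simp
    qed
    \<comment> \<open>Elements of the cokernel are their own representatives, so \<open>g2\<close>
      has a formula without the projection.\<close>
    moreover have "g2 x = psi Y (tens_map g1 x)" if "x \<in> carrier (coker_eta a P)" for x
      using *[OF c(5)[OF that]] c(6)[OF that] by simp
    ultimately show ?R
      using g(1) lin_mapsD(2)[OF g(2)] by (auto simp: extensional_def)
  next
    assume R: ?R
    then have g1: "g1 \<in> lin_maps K (sp2 P) (sp1 Y)" by blast
    note g1D = lin_mapsD(1)[OF g1]
    note h = module_hom_comp[OF tens_map_module_hom[OF PD(3) g1D] YD(6)]
    have z: "psi Y (tens_map g1 w) = \<zero>\<^bsub>sp2 Y\<^esub>" if "w \<in> eta a P ` carrier (sp1 P)" for w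
      using R that by blast
    have "g2 \<in> lin_maps K (coker_eta a P) (sp2 Y)"
      using R restrict_lin_maps[OF c(1), of "\<lambda>x. psi Y (tens_map g1 x)" "sp2 Y"]
        hom_quot[OF YD(3) h z] by (simp add: coker_eta_def)
    moreover have "g2 (eta_proj a P x) = psi Y (tens_map g1 x)" if x: "x \<in> carrier (tens a (sp2 P))" for x
      using R hom_proj[OF YD(3) h z x] module_hom_in[OF c(3) x] by (simp add: eta_proj_def)
    ultimately show ?L using g1 by (auto simp: krep_hom_def)
  qed
qed

text \<open>Common form of both adjunctions: \<open>F\<close> and \<open>G\<close> keep spaces and
  morphisms and change only structure maps, and \<open>psi_eta\<close> identifies the conditions on
  the shared component. It is used with \<open>F\<close>, \<open>G\<close> inflation and
  restriction, and the other way round.\<close>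

lemma sigma_inv_left_adjoint_sigma:
  fixes F G :: "('k, 'a) kfunctor" and K :: "('k, 'e) ring_scheme"
  assumes F: "is_functor (rep_cat K b) (rep_cat K a) F"
    and G: "is_functor (rep_cat K a) (rep_cat K b) G"
    and F_id: "\<And>M. sp1 (omap F M) = sp1 M" "\<And>M. sp2 (omap F M) = sp2 M" "\<And>M N f. fmap F M N f = f"
    and G_id: "\<And>M. sp1 (omap G M) = sp1 M" "\<And>M. sp2 (omap G M) = sp2 M" "\<And>M N f. fmap G M N f = f"
    and psi_eta: "\<And>X Y f x. is_krep K b X \<Longrightarrow> is_krep K a Y \<Longrightarrow> f \<in> lin_maps K (sp2 X) (sp1 Y) \<Longrightarrow>
      x \<in> carrier (sp1 X) \<Longrightarrow>
      psi Y (tens_map f (eta a (omap F X) x)) = psi (omap G Y) (tens_map f (eta b X x))"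
  shows "left_adjoint (rep_cat K b) (rep_cat K a) (sigma_inv a \<circ>F F) (sigma b \<circ>F G)"
proof -
  let ?B = "rep_cat K b :: (('k, 'a) krep, 'a kmor) category_data"
  let ?A = "rep_cat K a :: (('k, 'a) krep, 'a kmor) category_data"
  let ?L = "sigma_inv a \<circ>F F" and ?R = "sigma b \<circ>F G"
  \<comment> \<open>Keeps the component \<open>g1\<close> from \<open>sp2 X\<close> to
    \<open>sp1 Y\<close> and rebuilds the other one as \<open>sigma_hom_iff\<close>
    dictates.\<close>
  define \<Phi> :: "('k, 'a) krep \<Rightarrow> ('k, 'a) krep \<Rightarrow> 'a kmor \<Rightarrow> 'a kmor" where
    "\<Phi> X Y = (\<lambda>(g1, g2). ((\<lambda>x\<in>carrier (sp1 X). tens_map g1 (eta b X x)), g1))" for X Y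
  have FX: "is_krep K a (omap F X)" if "is_krep K b X" for X
    using F that by (auto simp: is_functor_def rep_cat_def)
  have GY: "is_krep K b (omap G Y)" if "is_krep K a Y" for Y
    using G that by (auto simp: is_functor_def rep_cat_def)
  have homL: "(g1, g2) \<in> Hom ?A (omap ?L X) Y \<longleftrightarrow>
      g1 \<in> lin_maps K (sp2 X) (sp1 Y) \<and>
      g2 = (\<lambda>x\<in>carrier (coker_eta a (omap F X)). psi Y (tens_map g1 x)) \<and>
      (\<forall>x\<in>carrier (sp1 X). psi Y (tens_map g1 (eta a (omap F X) x)) = \<zero>\<^bsub>sp2 Y\<^esub>)"
    if "is_krep K b X" "is_krep K a Y" for X Y g1 g2
    using sigma_inv_hom_iff[OF FX[OF that(1)] that(2)] by (simp add: rep_cat_def fun_comp_def F_id)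
  \<comment> \<open>\<open>psi_eta\<close> rewrites the vanishing condition into the form found in
    \<open>homL\<close>, so both hom-sets are parametrized by the same maps.\<close>
  have homR: "(f1, f2) \<in> Hom ?B X (omap ?R Y) \<longleftrightarrow>
      f2 \<in> lin_maps K (sp2 X) (sp1 Y) \<and> f1 = (\<lambda>x\<in>carrier (sp1 X). tens_map f2 (eta b X x)) \<and>
      (\<forall>x\<in>carrier (sp1 X). psi Y (tens_map f2 (eta a (omap F X) x)) = \<zero>\<^bsub>sp2 Y\<^esub>)"
    if "is_krep K b X" "is_krep K a Y" for X Y f1 f2
    using sigma_hom_iff[OF that(1) GY[OF that(2)]] psi_eta[OF that]
    by (auto simp: rep_cat_def fun_comp_def G_id)
  have "bij_betw (\<Phi> X Y) (Hom ?A (omap ?L X) Y) (Hom ?B X (omap ?R Y))"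
    if "is_krep K b X" "is_krep K a Y" for X Y
    \<comment> \<open>The inverse keeps the shared component and rebuilds the map on the cokernel as
      in \<open>homL\<close>.\<close>
    by (rule bij_betw_byWitness[where f' = "\<lambda>(f1, f2).
          (f2, \<lambda>x\<in>carrier (coker_eta a (omap F X)). psi Y (tens_map f2 x))"])
      (auto simp: \<Phi>_def homL[OF that] homR[OF that])
  moreover have "\<Phi> X' Y' (Comp ?A (omap ?L X') Y Y' v (Comp ?A (omap ?L X') (omap ?L X) Y f (fmap ?L X' X u)))
      = Comp ?B X' (omap ?R Y) (omap ?R Y') (fmap ?R Y Y' v) (Comp ?B X' X (omap ?R Y) (\<Phi> X Y f) u)"
    if X: "is_krep K b X" and X': "is_krep K b X'" and Y: "is_krep K a Y" and Y': "is_krep K a Y'"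
      and u: "u \<in> Hom ?B X' X" and v: "v \<in> Hom ?A Y Y'" and f: "f \<in> Hom ?A (omap ?L X) Y"
    for X X' Y Y' u v f
  proof -
    obtain u1 u2 v1 v2 f1 f2 where [simp]: "u = (u1, u2)" "v = (v1, v2)" "f = (f1, f2)"
      by (cases u, cases v, cases f)
    have u': "(u1, u2) \<in> krep_hom K b X' X" using u by (simp add: rep_cat_def)
    note uD = krep_homD[OF u']
    have ff: "\<Phi> X Y f \<in> Hom ?B X (omap ?R Y)"
      using f by (auto simp: \<Phi>_def homL[OF X Y] homR[OF X Y])
    \<comment> \<open>\<open>sigma\<close> on the morphism \<open>v\<close> is restricted to the
      kernel, so its argument has to be located there.\<close>
    have ker: "tens_map f1 (eta b X x) \<in> carrier (ker_psi b (omap G Y))" if "x \<in> carrier (sp1 X)" for x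
    proof -
      have "fst (\<Phi> X Y f) \<in> module_hom K (sp1 X) (ker_psi b (omap G Y))"
        using ff by (auto simp: rep_cat_def fun_comp_def krep_hom_def lin_maps_def sigma_def)
      from module_hom_in[OF this that] that show ?thesis by (simp add: \<Phi>_def)
    qed
    \<comment> \<open>The second components agree by unfolding; for the first ones the point is
      naturality of \<open>eta\<close> along \<open>u\<close>.\<close>
    have "tens_map (compose (carrier (sp2 X')) v1 (compose (carrier (sp2 X')) f1 u2)) (eta b X' x)
        = tens_map v1 (tens_map f1 (eta b X (u1 x)))" if x: "x \<in> carrier (sp1 X')" for x
    proof -
      note e = eta_closed[OF X' x]
      show ?thesis
        unfolding tens_map_compose[OF e] tens_map_eta[OF X' X u' x] ..
    qed
    then show ?thesis
      using ker module_hom_in[OF uD(3)]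
      by (auto simp: \<Phi>_def rep_cat_def fun_comp_def fmap_sigma_inv sigma_def F_id G_id compose_def)
  qed
  moreover have "is_functor ?B ?A ?L" "is_functor ?A ?B ?R"
    by (rule is_functor_fun_comp[OF F is_functor_sigma_inv] is_functor_fun_comp[OF G is_functor_sigma])+
  ultimately show ?thesis
    unfolding left_adjoint_def by (intro conjI exI[of _ \<Phi>]) (auto simp: rep_cat_def)
qed

text \<open>The added arrows act by zero on the inflation, so \<open>eta\<close> of it is
  \<open>eta s X\<close> padded with zeros. Since \<open>f\<close> preserves zero,
  \<open>psi Y\<close> sees the embedded tensor, which is how the restriction of \<open>Y\<close>
  acts.\<close>

lemma inf_res_psi_eta:
  assumes "s \<le> r" "is_krep K s X" "is_krep K r Y" "f \<in> lin_maps K (sp2 X) (sp1 Y)"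
    and "x \<in> carrier (sp1 X)"
  shows "psi Y (tens_map f (eta r (omap (inf_functor s r) X) x))
    = psi (omap (res_functor s r) Y) (tens_map f (eta s X x))"
proof -
  note X = is_krepD[OF assms(2)] and Y = is_krepD[OF assms(3)]
  interpret V: vectorspace K "sp1 X" by (rule X)
  have z: "psi X \<zero>\<^bsub>tens s (sp1 X)\<^esub> = \<zero>\<^bsub>sp2 X\<^esub>"
    by (rule module_hom_zero[OF vectorspace_tens[OF X(1)] X(3,6)])
  have f0: "f \<zero>\<^bsub>sp2 X\<^esub> = \<zero>\<^bsub>sp1 Y\<^esub>"
    by (rule module_hom_zero[OF X(3) Y(1) lin_mapsD(1)[OF assms(4)]])
  have e: "eta s X x \<in> carrier (tens s (sp2 X))" by (rule eta_closed[OF assms(2,5)])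
  have "eta r (omap (inf_functor s r) X) x = tens_embed s r (sp2 X) (eta s X x)"
    unfolding eta_def tens_embed_def univ.inject univ.sel
    using assms(1,5)
    by (intro nth_equalityI)
      (auto simp: inf_functor_def arr_closed tens_trunc_arr z nth_append)
  then show ?thesis
    using tens_map_in[OF lin_mapsD(1)[OF assms(4)] e]
    by (simp add: tens_map_embed[of f "sp2 X" "sp1 Y", OF f0] res_functor_def)
qed

text \<open>Restriction drops the last coordinates of \<open>eta r X\<close>, and the structure map
  of the inflation of \<open>Y\<close> truncates in the same place.\<close>

lemma res_inf_psi_eta:
  assumes "s \<le> r" "is_krep K r X" "is_krep K s Y" "f \<in> lin_maps K (sp2 X) (sp1 Y)"
    and "x \<in> carrier (sp1 X)"
  shows "psi Y (tens_map f (eta s (omap (res_functor s r) X) x))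
    = psi (omap (inf_functor s r) Y) (tens_map f (eta r X x))"
proof -
  note X = is_krepD[OF assms(2)]
  interpret V: vectorspace K "sp1 X" by (rule X)
  have e: "eta r X x \<in> carrier (tens r (sp2 X))" by (rule eta_closed[OF assms(2,5)])
  have "eta s (omap (res_functor s r) X) x = tens_trunc s (eta r X x)"
    using assms(1,5)
    by (auto simp: eta_def tens_trunc_def res_functor_def arr_closed tens_embed_arr take_map)
  then show ?thesis
    using tens_map_in[OF lin_mapsD(1)[OF assms(4)] e]
    by (simp add: tens_map_trunc inf_functor_def)
qed

theorem theorem1:
  fixes K :: "('k, 'e) ring_scheme" and n d :: nat
  assumes "algebraically_closed K"
    and "n \<ge> 2" and "1 \<le> d" and "d \<le> n"
  shows "left_adjoint
           (rep_cat K (d + 1) :: (('k, 'a) krep, 'a kmor) category_data) (rep_cat K (n + 1))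
           (sigma_inv (n + 1) \<circ>F inf_functor (d + 1) (n + 1))
           (sigma (d + 1) \<circ>F res_functor (d + 1) (n + 1))
       \<and> left_adjoint
           (rep_cat K (n + 1) :: (('k, 'a) krep, 'a kmor) category_data) (rep_cat K (d + 1))
           (sigma_inv (d + 1) \<circ>F res_functor (d + 1) (n + 1))
           (sigma (n + 1) \<circ>F inf_functor (d + 1) (n + 1))"
proof -
  have le: "d + 1 \<le> n + 1" using assms(4) by simp
  show ?thesis
    \<comment> \<open>Both parts are instances of one lemma; what is left for the simplifier is that
      inflation and restriction keep spaces and morphisms.\<close>
    by (intro conjI sigma_inv_left_adjoint_sigma is_functor_inf[OF le] is_functor_res[OF le]
        inf_res_psi_eta[OF le] res_inf_psi_eta[OF le])
      (simp_all add: inf_functor_def res_functor_def)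
qed

end
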